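(* Let $G_0$ be a group acting decently on a set $X_0$ with basepoint $x_0$. Let $k$ be a field, let $P=\mathbb{P}^2(k)$ and let $H=PGL_3(k)$ with its natural action on $P$. Let $\Gamma<G^{\oplus}$ be a finitely generated subgroup acting purely elliptically on $X=X_0^{\oplus P}$. If $\mathrm{proj}_H(\Gamma)$ is virtually solvable, then $\Gamma$ fixes a point of $X$.
   Context: **Decent action.** An action of a group $G$ on a set $Y$ is *purely elliptic* if every element of $G$ fixes a point of $Y$. An action of $G$ on $Y$ is *decent* if: (1) every subgroup of $G$ with a finite orbit on $Y$ fixes a point of $Y$; and (2) every finitely generated subgroup of $G$ acting purely elliptically on $Y$ fixes a point of $Y$. **Restricted product.** $X=X_0^{\oplus P}$ is the set of all $(y_p)_p\in\prod_{p\in P}X_0$ such that $y_p=x_0$ for all but finitely many $p\in P$. **The group $G^{\oplus}$.** Given actions of $H$ on $P$ and of $G_0$ on $X_0$, the unrestricted wreath product $G_0\wr_P H=\prod_P G_0\rtimes H$ acts on $\prod_P X_0$ by $(ghx)_p=g_p\,x_{h^{-1}p}$ for $g\in\prod_P G_0$, $h\in H$, $x=(x_p)_p\in\prod_P X_0$. $G^{\oplus}$ denotes the subgroup of $G_0\wr_P H$ preserving $X$. For $\Gamma<G_0\wr_P H$, $\mathrm{proj}_H(\Gamma)$ is the image of $\Gamma$ under the projection homomorphism $\prod_P G_0\rtimes H\to H$. *)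

theory Defs
  imports "HOL-Analysis.Analysis" "HOL-Algebra.Group_Action"
    "HOL-Algebra.Solvable_Groups" "HOL-Algebra.Product_Groups"
begin

subsection \<open>Group actions\<close>

text \<open>A subgroup \<open>K\<close> of \<open>G\<close> is treated as the group \<open>G\<lparr>carrier := K\<rparr>\<close>; the predicates
  below only evaluate the action at elements of the group and points of the set acted on,
  so the action map of the ambient group (on a possibly larger set) can be passed unchanged.\<close>

definition fixes_point :: "('a, 'm) monoid_scheme \<Rightarrow> 'y set \<Rightarrow> ('a \<Rightarrow> 'y \<Rightarrow> 'y) \<Rightarrow> bool" where
  "fixes_point G Y \<phi> \<longleftrightarrow> (\<exists>y\<in>Y. \<forall>g\<in>carrier G. \<phi> g y = y)"

definition purely_elliptic :: "('a, 'm) monoid_scheme \<Rightarrow> 'y set \<Rightarrow> ('a \<Rightarrow> 'y \<Rightarrow> 'y) \<Rightarrow> bool" where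
  "purely_elliptic G Y \<phi> \<longleftrightarrow> (\<forall>g\<in>carrier G. \<exists>y\<in>Y. \<phi> g y = y)"

definition finitely_generated :: "('a, 'm) monoid_scheme \<Rightarrow> bool" where
  "finitely_generated G \<longleftrightarrow> (\<exists>S. finite S \<and> S \<subseteq> carrier G \<and> generate G S = carrier G)"

definition decent_action :: "('a, 'm) monoid_scheme \<Rightarrow> 'y set \<Rightarrow> ('a \<Rightarrow> 'y \<Rightarrow> 'y) \<Rightarrow> bool" where
  "decent_action G Y \<phi> \<longleftrightarrow> group_action G Y \<phi> \<and>
     (\<forall>K. subgroup K G \<longrightarrow> (\<exists>y\<in>Y. finite (orbit (G\<lparr>carrier := K\<rparr>) \<phi> y)) \<longrightarrow>
        fixes_point (G\<lparr>carrier := K\<rparr>) Y \<phi>) \<and>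
     (\<forall>K. subgroup K G \<longrightarrow> finitely_generated (G\<lparr>carrier := K\<rparr>) \<longrightarrow>
        purely_elliptic (G\<lparr>carrier := K\<rparr>) Y \<phi> \<longrightarrow> fixes_point (G\<lparr>carrier := K\<rparr>) Y \<phi>)"

definition virtually_solvable :: "('a, 'm) monoid_scheme \<Rightarrow> bool" where
  "virtually_solvable G \<longleftrightarrow>
     (\<exists>K. subgroup K G \<and> finite (rcosets\<^bsub>G\<^esub> K) \<and> solvable (G\<lparr>carrier := K\<rparr>))"


subsection \<open>Restricted products and wreath products\<close>

definition restricted_product :: "'p set \<Rightarrow> 'x set \<Rightarrow> 'x \<Rightarrow> ('p \<Rightarrow> 'x) set" where
  "restricted_product P X0 x0 = {y \<in> P \<rightarrow>\<^sub>E X0. finite {p \<in> P. y p \<noteq> x0}}"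

text \<open>The unrestricted wreath product: the pair \<open>(g, h)\<close> stands for the product \<open>gh\<close> in the
  semidirect product, where \<open>h \<in> H\<close> conjugates the family \<open>g\<close> to \<open>p \<mapsto> g (h\<^sup>-\<^sup>1 p)\<close>.\<close>

definition wreath_product ::
  "('g, 'm) monoid_scheme \<Rightarrow> 'p set \<Rightarrow> ('h, 'n) monoid_scheme \<Rightarrow> ('h \<Rightarrow> 'p \<Rightarrow> 'p)
    \<Rightarrow> (('p \<Rightarrow> 'g) \<times> 'h) monoid" where
  "wreath_product G0 P H \<psi> =
     \<lparr>carrier = carrier (product_group P (\<lambda>_. G0)) \<times> carrier H,
      monoid.mult = (\<lambda>(g, h) (g', h').
        (g \<otimes>\<^bsub>product_group P (\<lambda>_. G0)\<^esub> (\<lambda>p\<in>P. g' (\<psi> (inv\<^bsub>H\<^esub> h) p)), h \<otimes>\<^bsub>H\<^esub> h')),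
      one = (\<one>\<^bsub>product_group P (\<lambda>_. G0)\<^esub>, \<one>\<^bsub>H\<^esub>)\<rparr>"

definition wreath_action ::
  "'x set \<Rightarrow> ('g \<Rightarrow> 'x \<Rightarrow> 'x) \<Rightarrow> 'p set \<Rightarrow> ('h, 'n) monoid_scheme \<Rightarrow> ('h \<Rightarrow> 'p \<Rightarrow> 'p)
    \<Rightarrow> ('p \<Rightarrow> 'g) \<times> 'h \<Rightarrow> ('p \<Rightarrow> 'x) \<Rightarrow> ('p \<Rightarrow> 'x)" where
  "wreath_action X0 \<phi> P H \<psi> =
     (\<lambda>(g, h). \<lambda>x \<in> P \<rightarrow>\<^sub>E X0. \<lambda>p\<in>P. \<phi> (g p) (x (\<psi> (inv\<^bsub>H\<^esub> h) p)))"

text \<open>The subgroup \<open>G\<^sup>\<oplus>\<close> of the wreath product preserving the restricted product.\<close>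

definition G_oplus ::
  "('g, 'm) monoid_scheme \<Rightarrow> 'x set \<Rightarrow> 'x \<Rightarrow> ('g \<Rightarrow> 'x \<Rightarrow> 'x)
    \<Rightarrow> 'p set \<Rightarrow> ('h, 'n) monoid_scheme \<Rightarrow> ('h \<Rightarrow> 'p \<Rightarrow> 'p) \<Rightarrow> (('p \<Rightarrow> 'g) \<times> 'h) monoid" where
  "G_oplus G0 X0 x0 \<phi> P H \<psi> = (wreath_product G0 P H \<psi>)
     \<lparr>carrier := {w \<in> carrier (wreath_product G0 P H \<psi>).
        wreath_action X0 \<phi> P H \<psi> w ` restricted_product P X0 x0 = restricted_product P X0 x0}\<rparr>"


subsection \<open>Projective space and the projective linear group\<close>

definition projective_space :: "('k::field ^ 'n) set set" where
  "projective_space = {L. vec.subspace L \<and> vec.dim L = 1}"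

definition GL :: "('k::field ^ 'n ^ 'n) monoid" where
  "GL = \<lparr>carrier = {A. invertible A}, monoid.mult = (**), one = mat 1\<rparr>"

definition PGL :: "('k::field ^ 'n ^ 'n) set monoid" where
  "PGL = GL Mod {mat c | c. c \<noteq> 0}"

text \<open>The matrices in a class \<open>C\<close> differ by nonzero scalars, so they all map a line \<open>L\<close> onto
  the same line; the union below is that line.\<close>

definition PGL_action :: "('k::field ^ 'n ^ 'n) set \<Rightarrow> ('k ^ 'n) set \<Rightarrow> ('k ^ 'n) set" where
  "PGL_action C = (\<lambda>L\<in>projective_space. \<Union>A\<in>C. (*v) A ` L)"

end

theory Submission
  imports Defs "HOL-Algebra.FiniteProduct"
begin

text \<open>A point of the restricted product is a section \<open>y\<close> of the bundle with fibre \<open>X0\<close> over the projective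
plane \<open>P\<close>, equal to \<open>x0\<close> almost everywhere. An element \<open>(g, h)\<close> of \<open>\<Gamma>\<close> carries the fibre over \<open>p\<close> to
the fibre over \<open>h p\<close> by the action of \<open>g (h p)\<close>; call \<open>y\<close> flat for \<open>(g, h)\<close> at \<open>p\<close> if \<open>y p\<close> is carried to
\<open>y (h p)\<close>. Then \<open>y\<close> is fixed by \<open>\<Gamma>\<close> if and only if it is flat everywhere, every section is flat for a given
element almost everywhere, and the orbits of \<open>\<Gamma>\<close> on \<open>P\<close> can be treated separately. Since \<open>\<Gamma>\<close> is
finitely generated, the constant section \<open>x0\<close> is flat on all but finitely many of them
(\<open>fixed_section\<close>).

On a finite orbit the stabiliser of an index is finitely generated and acts purely elliptically on its
fibre, so it has a fixed point there because the action on \<open>X0\<close> is decent; this point is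
transported around the orbit (\<open>finite_orbit_fixed_section\<close>).

On an infinite orbit decency is replaced by rigidity: a section fixed by an element \<open>c\<close> is forced at
every index with infinite \<open>c\<close>-orbit, because it equals \<open>x0\<close> far out on that orbit
(\<open>single_defect\<close>). Such \<open>c\<close> exist since a finitely generated torsion group that is virtually solvable is
finite. After passing to a power, every index is fixed or has infinite orbit under \<open>c\<close>. Let \<open>b\<close> be
a section fixed by \<open>c\<close>. In the derived series of a normal subgroup of finite index whose projection
is solvable, let \<open>B\<close> be the last term with infinite orbits and \<open>C\<close> the next one. The group \<open>C\<close> acts through a finite group that a power of
\<open>c\<close> centralises, so \<open>b\<close> is flat for \<open>C\<close> where \<open>c\<close> moves (\<open>finite_normal_flat\<close>). Elements of \<open>B\<close>
commute up to \<open>C\<close> with the conjugates of other elements of \<open>B\<close> by high powers of \<open>c\<close>, and the defects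
of these conjugates escape to infinity; comparing the two orders of multiplication shows that \<open>b\<close> is flat for
\<open>B\<close> as well (\<open>coherent_on_normal\<close>). A section that is flat for \<open>B\<close> is unique because the orbits of \<open>B\<close> are
infinite, and uniqueness together with normality of \<open>B\<close> upgrades flatness to the whole group
(\<open>invariant_section\<close>).

The projective plane enters only through a chain condition: chains of common fixed point sets of
subsets of \<open>PGL\<close> have bounded length, since fixing the line through \<open>v\<close> is a linear condition on the tensor
\<open>v \<otimes> v\<close> (\<open>PGL_bounded_fixpoint_chains\<close>).\<close>

section \<open>Subgroups of finite index\<close>

text \<open>Representatives of the right cosets, rather than the set of cosets, are recorded: they are what
Schreier's lemma works with, and the predicate then also makes sense for sets \<open>K\<close> that have not
yet been shown to be subgroups.\<close>

definition finite_index :: "('a, 'm) monoid_scheme \<Rightarrow> 'a set \<Rightarrow> bool" where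
  "finite_index G K \<longleftrightarrow>
     (\<exists>T\<subseteq>carrier G. finite T \<and> (\<forall>a\<in>carrier G. \<exists>t\<in>T. a \<otimes>\<^bsub>G\<^esub> inv\<^bsub>G\<^esub> t \<in> K))"

context group
begin

lemma inv_cancel_left: "a \<in> carrier G \<Longrightarrow> b \<in> carrier G \<Longrightarrow> inv a \<otimes> (a \<otimes> b) = b"
  and cancel_inv_left: "a \<in> carrier G \<Longrightarrow> b \<in> carrier G \<Longrightarrow> a \<otimes> (inv a \<otimes> b) = b"
  by (simp_all add: m_assoc[symmetric])

text \<open>Stabilisers, cores and preimages are recognised as having finite index by an invariant with finitely
many values that separates the cosets.\<close>

lemma finite_index_by_invariant:
  assumes "finite (f ` carrier G)"
    and "\<And>a b. a \<in> carrier G \<Longrightarrow> b \<in> carrier G \<Longrightarrow> f a = f b \<Longrightarrow> a \<otimes> inv b \<in> K"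
  shows "finite_index G K"
proof -
  have "\<forall>v\<in>f ` carrier G. \<exists>a. a \<in> carrier G \<and> f a = v" by blast
  then obtain r where r: "\<And>v. v \<in> f ` carrier G \<Longrightarrow> r v \<in> carrier G \<and> f (r v) = v" by metis
  show ?thesis unfolding finite_index_def
  proof (intro exI[of _ "r ` f ` carrier G"] conjI ballI)
    show "r ` f ` carrier G \<subseteq> carrier G" using r by blast
    show "finite (r ` f ` carrier G)" using assms(1) by blast
    fix a assume a: "a \<in> carrier G"
    then have "a \<otimes> inv (r (f a)) \<in> K" using assms(2) r by (metis imageI)
    then show "\<exists>t\<in>r ` f ` carrier G. a \<otimes> inv t \<in> K" using a by blast
  qed
qed

lemma finite_index_trans:
  assumes "finite_index G K" "subgroup K G" "finite_index (G\<lparr>carrier := K\<rparr>) D"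
  shows "finite_index G D"
proof -
  obtain T where T: "T \<subseteq> carrier G" "finite T" "\<And>a. a \<in> carrier G \<Longrightarrow> \<exists>t\<in>T. a \<otimes> inv t \<in> K"
    using assms(1) unfolding finite_index_def by metis
  obtain U where U: "U \<subseteq> K" "finite U" "\<And>a. a \<in> K \<Longrightarrow> \<exists>u\<in>U. a \<otimes> inv u \<in> D"
    using assms(3) m_inv_consistent[OF assms(2)] unfolding finite_index_def by simp (metis subsetD)
  have KG: "K \<subseteq> carrier G" using assms(2) by (rule subgroup.subset)
  show ?thesis unfolding finite_index_def
  proof (intro exI[of _ "(\<lambda>(u, t). u \<otimes> t) ` (U \<times> T)"] conjI ballI)
    show "(\<lambda>(u, t). u \<otimes> t) ` (U \<times> T) \<subseteq> carrier G" using U(1) T(1) KG by auto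
    show "finite ((\<lambda>(u, t). u \<otimes> t) ` (U \<times> T))" using U(2) T(2) by blast
    fix a assume a: "a \<in> carrier G"
    obtain t where t: "t \<in> T" "a \<otimes> inv t \<in> K" using T(3)[OF a] by blast
    obtain u where u: "u \<in> U" "a \<otimes> inv t \<otimes> inv u \<in> D" using U(3)[OF t(2)] by blast
    have c: "t \<in> carrier G" "u \<in> carrier G" using t(1) u(1) T(1) U(1) KG by blast+
    have "a \<otimes> inv (u \<otimes> t) \<in> D" using u(2) a c by (simp add: inv_mult_group m_assoc)
    then show "\<exists>s\<in>(\<lambda>(u, t). u \<otimes> t) ` (U \<times> T). a \<otimes> inv s \<in> D" using u(1) t(1) by force
  qed
qed

lemma finite_index_if_finite_rcosets:
  assumes "subgroup K G" "finite (rcosets K)"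
  shows "finite_index G K"
proof (rule finite_index_by_invariant[where f = "\<lambda>a. K #> a"])
  have "(\<lambda>a. K #> a) ` carrier G = rcosets K" by (auto simp: RCOSETS_def)
  then show "finite ((\<lambda>a. K #> a) ` carrier G)" using assms(2) by simp
next
  fix a b assume a: "a \<in> carrier G" and b: "b \<in> carrier G" and e: "K #> a = K #> b"
  have "a \<in> K #> b" using e a assms(1) by (metis rcos_self)
  then obtain k where "k \<in> K" "a = k \<otimes> b" unfolding r_coset_def by blast
  then show "a \<otimes> inv b \<in> K" using b subgroup.mem_carrier[OF assms(1)] by (simp add: m_assoc)
qed

text \<open>Schreier's lemma. With \<open>T\<close> a finite set of coset representatives, every product \<open>t \<otimes> s\<close> of a
representative and a generator is \<open>k \<otimes> t'\<close> for an element \<open>k = t \<otimes> s \<otimes> inv t'\<close> of \<open>K\<close>. These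
finitely many \<open>k\<close>, together with the representatives that happen to lie in \<open>K\<close>, generate \<open>K\<close>:
the products of a word in the \<open>k\<close> with a representative are closed under multiplication by
generators, so they exhaust the group.\<close>

lemma finitely_generated_if_finite_index:
  assumes fg: "finitely_generated G" and K: "subgroup K G" and fi: "finite_index G K"
  shows "\<exists>Y. finite Y \<and> Y \<subseteq> K \<and> generate G Y = K"
proof -
  obtain S where S: "finite S" "S \<subseteq> carrier G" "generate G S = carrier G"
    using fg unfolding finitely_generated_def by blast
  obtain T0 where T0: "T0 \<subseteq> carrier G" "finite T0" "\<And>a. a \<in> carrier G \<Longrightarrow> \<exists>t\<in>T0. a \<otimes> inv t \<in> K"
    using fi unfolding finite_index_def by metis
  define T where "T = insert \<one> T0"
  have T: "T \<subseteq> carrier G" "finite T" "\<one> \<in> T" "\<And>a. a \<in> carrier G \<Longrightarrow> \<exists>t\<in>T. a \<otimes> inv t \<in> K"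
    using T0 unfolding T_def by auto
  define S' where "S' = S \<union> m_inv G ` S"
  define V where "V = (\<lambda>(t, s, t'). t \<otimes> s \<otimes> inv t') ` (T \<times> S' \<times> T)"
  define Y where "Y = K \<inter> (V \<union> T)"
  have S': "finite S'" "S' \<subseteq> carrier G" using S unfolding S'_def by auto
  have YK: "Y \<subseteq> K" unfolding Y_def by blast
  have finY: "finite Y" unfolding Y_def V_def using T(2) S'(1) by blast
  have KG: "K \<subseteq> carrier G" using K by (rule subgroup.subset)
  have YG: "Y \<subseteq> carrier G" using YK KG by blast
  interpret Yg: subgroup "generate G Y" G by (rule generate_is_subgroup[OF YG])
  have step: "\<exists>u\<in>generate G Y. \<exists>t\<in>T. u' \<otimes> t' \<otimes> s = u \<otimes> t"
    if u': "u' \<in> generate G Y" and t': "t' \<in> T" and s: "s \<in> S'" for u' t' s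
  proof -
    have c: "t' \<in> carrier G" "s \<in> carrier G" "u' \<in> carrier G"
      using T(1) S'(2) t' s Yg.mem_carrier[OF u'] by auto
    obtain t where t: "t \<in> T" "t' \<otimes> s \<otimes> inv t \<in> K" using T(4)[of "t' \<otimes> s"] c by auto
    have tc: "t \<in> carrier G" using t T by blast
    have "t' \<otimes> s \<otimes> inv t \<in> V" unfolding V_def using t' s t(1) by force
    then have "t' \<otimes> s \<otimes> inv t \<in> Y" using t(2) unfolding Y_def by blast
    then have "u' \<otimes> (t' \<otimes> s \<otimes> inv t) \<in> generate G Y" using u' by (simp add: generate.incl generate.eng)
    moreover have "u' \<otimes> t' \<otimes> s = u' \<otimes> (t' \<otimes> s \<otimes> inv t) \<otimes> t" using c tc by (simp add: m_assoc)
    ultimately show ?thesis using t(1) by blast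
  qed
  have all: "\<forall>u'\<in>generate G Y. \<forall>t'\<in>T. \<exists>u\<in>generate G Y. \<exists>t\<in>T. u' \<otimes> t' \<otimes> a = u \<otimes> t"
    if "a \<in> generate G S" for a
    using that
  proof (induct a rule: generate.induct)
    case one
    show ?case
    proof (intro ballI)
      fix u' t' assume h: "u' \<in> generate G Y" "t' \<in> T"
      then have "u' \<otimes> t' \<otimes> \<one> = u' \<otimes> t'" using T(1) Yg.mem_carrier by (simp add: subset_iff)
      then show "\<exists>u\<in>generate G Y. \<exists>t\<in>T. u' \<otimes> t' \<otimes> \<one> = u \<otimes> t" using h by blast
    qed
  next
    case (incl h)
    then show ?case using step unfolding S'_def by blast
  next
    case (inv h)
    then show ?case using step unfolding S'_def by blast
  next
    case (eng h1 h2)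
    have c: "h1 \<in> carrier G" "h2 \<in> carrier G" using eng S(3) by auto
    show ?case
    proof (intro ballI)
      fix u' t' assume h: "u' \<in> generate G Y" "t' \<in> T"
      obtain u t where ut: "u \<in> generate G Y" "t \<in> T" "u' \<otimes> t' \<otimes> h1 = u \<otimes> t" using eng(2) h by blast
      obtain v s where vs: "v \<in> generate G Y" "s \<in> T" "u \<otimes> t \<otimes> h2 = v \<otimes> s" using eng(4) ut by blast
      have "u' \<otimes> t' \<otimes> (h1 \<otimes> h2) = u' \<otimes> t' \<otimes> h1 \<otimes> h2"
        using c h T(1) Yg.mem_carrier by (simp add: m_assoc subset_iff)
      then show "\<exists>u\<in>generate G Y. \<exists>t\<in>T. u' \<otimes> t' \<otimes> (h1 \<otimes> h2) = u \<otimes> t" using ut vs by metis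
    qed
  qed
  have "K \<subseteq> generate G Y"
  proof
    fix k assume k: "k \<in> K"
    then have "k \<in> generate G S" using KG S(3) by blast
    from all[OF this] obtain u t where ut: "u \<in> generate G Y" "t \<in> T" "\<one> \<otimes> \<one> \<otimes> k = u \<otimes> t"
      using T(3) Yg.one_closed by blast
    have c: "u \<in> carrier G" "t \<in> carrier G" "k \<in> carrier G" using ut T(1) Yg.mem_carrier k KG by auto
    have eq: "k = u \<otimes> t" using ut(3) c by simp
    have uK: "u \<in> K" using ut(1) generate_subgroup_incl[OF YK K] by blast
    have "t = inv u \<otimes> k" using eq c by (simp add: inv_solve_left)
    then have "t \<in> K" using uK k K by (simp add: subgroup.m_inv_closed subgroup.m_closed)
    then have "t \<in> Y" using ut(2) unfolding Y_def by blast
    then show "k \<in> generate G Y" using eq ut(1) by (simp add: generate.incl generate.eng)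
  qed
  moreover have "generate G Y \<subseteq> K" by (rule generate_subgroup_incl[OF YK K])
  ultimately show ?thesis using finY YK by blast
qed

text \<open>The core is the set of elements all of whose conjugates lie in \<open>K\<close>. Only the conjugates by coset
representatives matter, and they are controlled by the permutation of the finitely many cosets
that the element induces; the resulting map of representatives is the invariant used for the index.\<close>

lemma normal_core_finite_index:
  assumes K: "subgroup K G" and fi: "finite_index G K"
  shows "\<exists>L. L \<lhd> G \<and> L \<subseteq> K \<and> finite_index G L"
proof -
  obtain T where T: "T \<subseteq> carrier G" "finite T" "\<And>a. a \<in> carrier G \<Longrightarrow> \<exists>t\<in>T. a \<otimes> inv t \<in> K"
    using fi unfolding finite_index_def by metis
  define L where "L = {a \<in> carrier G. \<forall>g\<in>carrier G. g \<otimes> a \<otimes> inv g \<in> K}"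
  have KG: "K \<subseteq> carrier G" using K by (rule subgroup.subset)
  have LK: "L \<subseteq> K"
  proof
    fix a assume "a \<in> L"
    then have "a \<in> carrier G" "\<one> \<otimes> a \<otimes> inv \<one> \<in> K" unfolding L_def by blast+
    then show "a \<in> K" by simp
  qed
  have cm: "g \<otimes> (a \<otimes> b) \<otimes> inv g = (g \<otimes> a \<otimes> inv g) \<otimes> (g \<otimes> b \<otimes> inv g)"
    if "a \<in> carrier G" "b \<in> carrier G" "g \<in> carrier G" for a b g
    using that by (simp add: m_assoc inv_cancel_left)
  have ci: "g \<otimes> inv a \<otimes> inv g = inv (g \<otimes> a \<otimes> inv g)"
    if "a \<in> carrier G" "g \<in> carrier G" for a g
    using that by (simp add: m_assoc inv_mult_group)
  have sub: "subgroup L G"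
  proof (rule subgroupI)
    show "L \<subseteq> carrier G" unfolding L_def by blast
    have "\<one> \<in> L" unfolding L_def using subgroup.one_closed[OF K] by simp
    then show "L \<noteq> {}" by blast
  next
    fix a assume "a \<in> L"
    then show "inv a \<in> L" unfolding L_def using ci subgroup.m_inv_closed[OF K] by simp
  next
    fix a b assume "a \<in> L" "b \<in> L"
    then show "a \<otimes> b \<in> L" unfolding L_def using cm subgroup.m_closed[OF K] by simp
  qed
  have norm: "L \<lhd> G"
  proof (rule normal_invI[OF sub])
    fix x h assume x: "x \<in> carrier G" and h: "h \<in> L"
    have hc: "h \<in> carrier G" using h unfolding L_def by blast
    have "g \<otimes> (x \<otimes> h \<otimes> inv x) \<otimes> inv g \<in> K" if g: "g \<in> carrier G" for g
    proof -
      have "g \<otimes> (x \<otimes> h \<otimes> inv x) \<otimes> inv g = (g \<otimes> x) \<otimes> h \<otimes> inv (g \<otimes> x)"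
        using g x hc by (simp add: m_assoc inv_mult_group)
      then show ?thesis using h g x unfolding L_def by simp
    qed
    then show "x \<otimes> h \<otimes> inv x \<in> L" unfolding L_def using x hc by simp
  qed
  have "finite_index G L"
  proof (rule finite_index_by_invariant[where f = "\<lambda>a. \<lambda>t\<in>T. SOME s. s \<in> T \<and> t \<otimes> a \<otimes> inv s \<in> K"])
    let ?f = "\<lambda>a. \<lambda>t\<in>T. SOME s. s \<in> T \<and> t \<otimes> a \<otimes> inv s \<in> K"
    have f: "?f a t \<in> T \<and> t \<otimes> a \<otimes> inv (?f a t) \<in> K" if "a \<in> carrier G" "t \<in> T" for a t
    proof -
      have "\<exists>s. s \<in> T \<and> t \<otimes> a \<otimes> inv s \<in> K" using T(3)[of "t \<otimes> a"] T(1) that by auto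
      from someI_ex[OF this] show ?thesis using that by simp
    qed
    have "?f ` carrier G \<subseteq> T \<rightarrow>\<^sub>E T" using f by (auto simp: PiE_iff extensional_def)
    then show "finite (?f ` carrier G)" using T(2) finite_PiE[of T "\<lambda>_. T"] finite_subset by blast
    fix a b assume a: "a \<in> carrier G" and b: "b \<in> carrier G" and e: "?f a = ?f b"
    have inT: "t \<otimes> (a \<otimes> inv b) \<otimes> inv t \<in> K" if t: "t \<in> T" for t
    proof -
      define s where "s = ?f a t"
      have s: "s \<in> T" "t \<otimes> a \<otimes> inv s \<in> K" "t \<otimes> b \<otimes> inv s \<in> K"
        using f[OF a t] f[OF b t] e unfolding s_def by auto
      have c: "s \<in> carrier G" "t \<in> carrier G" using s(1) t T(1) by auto
      have "(t \<otimes> a \<otimes> inv s) \<otimes> inv (t \<otimes> b \<otimes> inv s) \<in> K"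
        using s K by (simp add: subgroup.m_inv_closed subgroup.m_closed)
      moreover have "(t \<otimes> a \<otimes> inv s) \<otimes> inv (t \<otimes> b \<otimes> inv s) = t \<otimes> (a \<otimes> inv b) \<otimes> inv t"
        using c a b by (simp add: m_assoc inv_mult_group inv_cancel_left)
      ultimately show ?thesis by simp
    qed
    have "g \<otimes> (a \<otimes> inv b) \<otimes> inv g \<in> K" if g: "g \<in> carrier G" for g
    proof -
      obtain t where t: "t \<in> T" "g \<otimes> inv t \<in> K" using T(3)[OF g] by blast
      have tc: "t \<in> carrier G" using t T by blast
      have "(g \<otimes> inv t) \<otimes> (t \<otimes> (a \<otimes> inv b) \<otimes> inv t) \<otimes> inv (g \<otimes> inv t) \<in> K"
        using t(2) inT[OF t(1)] K by (simp add: subgroup.m_inv_closed subgroup.m_closed)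
      moreover have "(g \<otimes> inv t) \<otimes> (t \<otimes> (a \<otimes> inv b) \<otimes> inv t) \<otimes> inv (g \<otimes> inv t) = g \<otimes> (a \<otimes> inv b) \<otimes> inv g"
        using tc a b g by (simp add: m_assoc inv_mult_group inv_cancel_left)
      ultimately show ?thesis by simp
    qed
    then show "a \<otimes> inv b \<in> L" unfolding L_def using a b by simp
  qed
  then show ?thesis using norm LK by blast
qed

end

section \<open>Finitely generated torsion groups that are virtually solvable\<close>

text \<open>The product over \<open>Y\<close> of the powers with exponents \<open>e y\<close> depends only on the exponents modulo the
orders of the generators, and these products form a subgroup.\<close>

lemma (in comm_group) finite_if_generated_by_torsion:
  assumes Y: "finite Y" "Y \<subseteq> carrier G" and gen: "generate G Y = carrier G"
    and tor: "\<And>y. y \<in> Y \<Longrightarrow> \<exists>n>0. y [^] (n::nat) = \<one>"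
  shows "finite (carrier G)"
proof -
  obtain n where n: "\<And>y. y \<in> Y \<Longrightarrow> n y > 0 \<and> y [^] (n y::nat) = \<one>" using tor by metis
  define w where "w e = finprod G (\<lambda>y. y [^] (e y::nat)) Y" for e :: "'a \<Rightarrow> nat"
  have wc: "w e \<in> carrier G" for e unfolding w_def using Y(2) by (intro finprod_closed) auto
  have wm: "w e \<otimes> w e' = w (\<lambda>y. e y + e' y)" for e e'
  proof -
    have "w (\<lambda>y. e y + e' y) = finprod G (\<lambda>y. y [^] e y \<otimes> y [^] e' y) Y"
      unfolding w_def using Y(2) by (intro finprod_cong') (auto simp: nat_pow_mult subset_iff)
    also have "\<dots> = w e \<otimes> w e'" unfolding w_def using Y(2) by (intro finprod_multf) auto
    finally show ?thesis by simp
  qed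
  have wy: "w (\<lambda>z. if z = y then k else 0) = y [^] k" if y: "y \<in> Y" for y k
  proof -
    have "w (\<lambda>z. if z = y then k else 0) = finprod G (\<lambda>z. if y = z then z [^] k else \<one>) Y"
      unfolding w_def using Y(2) by (intro finprod_cong') auto
    also have "\<dots> = y [^] k" using finprod_singleton[OF y Y(1), of "\<lambda>z. z [^] k"] Y(2) by auto
    finally show ?thesis .
  qed
  have w1: "w (\<lambda>_. 0) = \<one>" unfolding w_def by (intro finprod_one_eqI) auto
  have "carrier G \<subseteq> range w"
  proof
    fix a assume "a \<in> carrier G"
    then have "a \<in> generate G Y" using gen by simp
    then show "a \<in> range w"
    proof (induct a rule: generate.induct)
      case one
      then show ?case using w1 by (metis rangeI)
    next
      case (incl h)
      then have "w (\<lambda>z. if z = h then 1 else 0) = h" using wy[of h 1] Y(2) by auto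
      then show ?case by (metis rangeI)
    next
      case (inv h)
      then have h: "h \<in> carrier G" "n h > 0" "h [^] n h = \<one>" using Y(2) n by auto
      have "h [^] (n h - 1) \<otimes> h = \<one>" using h by (metis One_nat_def Suc_pred nat_pow_Suc)
      then have "inv h = h [^] (n h - 1)" using h by (metis inv_equality nat_pow_closed)
      then show ?case using wy[OF inv] by (metis rangeI)
    next
      case (eng h1 h2)
      then show ?case using wm by (metis (no_types, lifting) image_iff rangeI)
    qed
  qed
  also have "range w \<subseteq> w ` (PiE Y (\<lambda>y. {..<n y}))"
  proof
    fix a assume "a \<in> range w"
    then obtain e where e: "a = w e" by blast
    have "w e = w (\<lambda>y\<in>Y. e y mod n y)"
      unfolding w_def
    proof (rule finprod_cong')
      show "(\<lambda>y. y [^] (\<lambda>y\<in>Y. e y mod n y) y) \<in> Y \<rightarrow> carrier G" using Y(2) by auto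
      fix y assume y: "y \<in> Y"
      then have c: "y \<in> carrier G" "y [^] n y = \<one>" using Y(2) n by auto
      have "y [^] e y = y [^] (n y * (e y div n y) + e y mod n y)" by simp
      also have "\<dots> = (y [^] n y) [^] (e y div n y) \<otimes> y [^] (e y mod n y)"
        using c(1) by (simp only: nat_pow_mult nat_pow_pow)
      also have "\<dots> = y [^] (e y mod n y)" using c by simp
      finally show "y [^] e y = y [^] (\<lambda>y\<in>Y. e y mod n y) y" using y by simp
    qed simp
    moreover have "(\<lambda>y\<in>Y. e y mod n y) \<in> PiE Y (\<lambda>y. {..<n y})" using n by auto
    ultimately show "a \<in> w ` (PiE Y (\<lambda>y. {..<n y}))" using e by blast
  qed
  finally show ?thesis
    using finite_surj[of "PiE Y (\<lambda>y. {..<n y})" "carrier G" w] Y(1) by (simp add: finite_PiE)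
qed

context group
begin

lemma finite_index_derived:
  assumes fg: "finitely_generated G" and tor: "\<And>a. a \<in> carrier G \<Longrightarrow> \<exists>n>0. a [^] (n::nat) = \<one>"
    and K: "subgroup K G" and fi: "finite_index G K"
  shows "finite_index G (derived G K)"
proof -
  let ?K = "G\<lparr>carrier := K\<rparr>"
  let ?D = "derived G K"
  obtain Y where Y: "finite Y" "Y \<subseteq> K" "generate G Y = K"
    using finitely_generated_if_finite_index[OF fg K fi] by blast
  have KG: "K \<subseteq> carrier G" using K by (rule subgroup.subset)
  have gK: "group ?K" using K by (rule subgroup_imp_group)
  have nD: "?D \<lhd> ?K" by (rule derived_subgroup_is_normal[OF K])
  interpret D: normal ?D ?K by (rule nD)
  interpret Q: comm_group "?K Mod ?D" by (rule derived_quot_of_subgroup_is_comm_group[OF K])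
  interpret h: group_hom ?K "?K Mod ?D" "\<lambda>a. ?D #>\<^bsub>?K\<^esub> a"
    using D.r_coset_hom_Mod gK Q.is_group by (simp add: group_hom_def group_hom_axioms_def)
  have "finite (carrier (?K Mod ?D))"
  proof (rule Q.finite_if_generated_by_torsion)
    show "finite ((\<lambda>a. ?D #>\<^bsub>?K\<^esub> a) ` Y)" using Y by simp
    show "(\<lambda>a. ?D #>\<^bsub>?K\<^esub> a) ` Y \<subseteq> carrier (?K Mod ?D)" using Y(2) h.hom_closed by auto
    have "generate ?K Y = K" using generate_consistent[OF Y(2) K] Y(3) by simp
    then show "generate (?K Mod ?D) ((\<lambda>a. ?D #>\<^bsub>?K\<^esub> a) ` Y) = carrier (?K Mod ?D)"
      using h.generate_img[of Y] Y(2) by (simp add: carrier_FactGroup)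
  next
    fix z assume "z \<in> (\<lambda>a. ?D #>\<^bsub>?K\<^esub> a) ` Y"
    then obtain y where y: "y \<in> K" "z = ?D #>\<^bsub>?K\<^esub> y" using Y(2) by blast
    obtain n :: nat where n: "n > 0" "y [^] n = \<one>" using tor y(1) KG by blast
    have "z [^]\<^bsub>?K Mod ?D\<^esub> n = ?D #>\<^bsub>?K\<^esub> (y [^]\<^bsub>?K\<^esub> n)"
      using h.hom_nat_pow[of y n] y by simp
    also have "y [^]\<^bsub>?K\<^esub> n = \<one>\<^bsub>?K\<^esub>" using n(2) by (simp add: nat_pow_consistent[symmetric])
    also have "?D #>\<^bsub>?K\<^esub> \<one>\<^bsub>?K\<^esub> = \<one>\<^bsub>?K Mod ?D\<^esub>" by (rule h.hom_one)
    finally show "\<exists>n>0. z [^]\<^bsub>?K Mod ?D\<^esub> (n::nat) = \<one>\<^bsub>?K Mod ?D\<^esub>" using n(1) by blast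
  qed
  then have "finite (rcosets\<^bsub>?K\<^esub> ?D)" by (simp add: FactGroup_def)
  then have "finite_index ?K ?D"
    using group.finite_index_if_finite_rcosets[OF gK D.subgroup_axioms] by blast
  then show ?thesis by (rule finite_index_trans[OF fi K])
qed

text \<open>Descending the derived series keeps the index finite: a term of finite index is finitely generated
by Schreier's lemma, so its abelianisation is a finitely generated abelian torsion group, hence
finite. The last term is trivial and of finite index.\<close>

lemma finite_if_torsion_virtually_solvable:
  assumes fg: "finitely_generated G" and tor: "\<And>a. a \<in> carrier G \<Longrightarrow> \<exists>n>0. a [^] (n::nat) = \<one>"
    and "subgroup K G" "finite_index G K" "(derived G ^^ n) K = {\<one>}"
  shows "finite (carrier G)"
  using assms(3-5)
proof (induct n arbitrary: K)
  case 0
  then obtain T where T: "finite T" "\<forall>a\<in>carrier G. \<exists>t\<in>T. a \<otimes> inv t = \<one>" "T \<subseteq> carrier G"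
    unfolding finite_index_def by auto
  have "carrier G \<subseteq> T"
  proof
    fix a assume a: "a \<in> carrier G"
    then obtain t where t: "t \<in> T" "a \<otimes> inv t = \<one>" using T(2) by blast
    then have "a = t" using a T(3) by (metis inv_closed inv_equality inv_inv subsetD)
    then show "a \<in> T" using t by simp
  qed
  then show ?case using T(1) finite_subset by blast
next
  case (Suc n)
  show ?case
  proof (rule Suc.hyps)
    show "subgroup (derived G K) G" using Suc.prems(1) by (simp add: derived_is_subgroup subgroup.subset)
    show "finite_index G (derived G K)" by (rule finite_index_derived[OF fg tor Suc.prems(1,2)])
    show "(derived G ^^ n) (derived G K) = {\<one>}" using Suc.prems(3) by (simp add: funpow_swap1)
  qed
qed

end

section \<open>Bundles of fibres and their sections\<close>

text \<open>The next two lemmas propagate a property along an infinite orbit, indexed by the integers, from the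
far end at which it holds.\<close>

lemma int_descend:
  fixes Q :: "int \<Rightarrow> bool"
  assumes fin: "finite {i. \<not> Q i}" and step: "\<And>i. k \<le> i \<Longrightarrow> Q (i + 1) \<Longrightarrow> Q i"
  shows "Q k"
proof -
  have "infinite {k..}" by (rule infinite_Ici)
  then obtain j where j: "k \<le> j" "Q j" using fin finite_subset[of "{k..}" "{i. \<not> Q i}"] by auto
  have "k \<le> k \<longrightarrow> Q k"
    using j(1)
  proof (induct k rule: int_le_induct[where P = "\<lambda>i. k \<le> i \<longrightarrow> Q i"])
    case base
    show ?case using j(2) by simp
  next
    case (step i)
    then show ?case using assms(2)[of "i - 1"] by auto
  qed
  then show ?thesis by simp
qed

lemma int_ascend:
  fixes Q :: "int \<Rightarrow> bool"
  assumes fin: "finite {i. \<not> Q i}" and step: "\<And>i. i < k \<Longrightarrow> Q i \<Longrightarrow> Q (i + 1)"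
  shows "Q k"
proof -
  have "Q (- (- k))"
  proof (rule int_descend[where Q = "\<lambda>i. Q (- i)"])
    have "{i. \<not> Q (- i)} = uminus ` {i. \<not> Q i}" by force
    then show "finite {i. \<not> Q (- i)}" using fin by simp
    fix i assume "- k \<le> i" "Q (- (i + 1))"
    then show "Q (- i)" using step[of "- (i + 1)"] by simp
  qed
  then show ?thesis by simp
qed

text \<open>The restricted product is seen as a set of sections of the bundle with fibre \<open>X0\<close> over \<open>P\<close>. A group
element \<open>a\<close> moves the index \<open>p\<close> to \<open>act a p\<close> and carries the fibre over \<open>p\<close> to the fibre over
\<open>act a p\<close> by \<open>tr a p\<close>. Being fixed by \<open>a\<close> becomes a local condition, flatness at every index, and
it is the local condition that the proof manipulates.\<close>

definition flat :: "('a \<Rightarrow> 'p \<Rightarrow> 'p) \<Rightarrow> ('a \<Rightarrow> 'p \<Rightarrow> 'x \<Rightarrow> 'x) \<Rightarrow> 'a \<Rightarrow> ('p \<Rightarrow> 'x) \<Rightarrow> 'p \<Rightarrow> bool" where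
  "flat act tr a y p \<longleftrightarrow> tr a p (y p) = y (act a p)"

definition finite_section :: "'p set \<Rightarrow> 'x set \<Rightarrow> 'x \<Rightarrow> ('p \<Rightarrow> 'x) \<Rightarrow> bool" where
  "finite_section P X0 x0 y \<longleftrightarrow> (\<forall>p\<in>P. y p \<in> X0) \<and> finite {p \<in> P. y p \<noteq> x0}"

definition common_fixpoints :: "'p set \<Rightarrow> ('a \<Rightarrow> 'p \<Rightarrow> 'p) \<Rightarrow> 'a set \<Rightarrow> 'p set" where
  "common_fixpoints P act S = {p \<in> P. \<forall>a\<in>S. act a p = p}"

locale bundle_action = group G for G (structure) +
  fixes P :: "'p set" and act :: "'a \<Rightarrow> 'p \<Rightarrow> 'p"
    and X0 :: "'x set" and tr :: "'a \<Rightarrow> 'p \<Rightarrow> 'x \<Rightarrow> 'x" and x0 :: 'x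
  assumes act_closed: "a \<in> carrier G \<Longrightarrow> p \<in> P \<Longrightarrow> act a p \<in> P"
    and act_one: "p \<in> P \<Longrightarrow> act \<one> p = p"
    and act_mult: "a \<in> carrier G \<Longrightarrow> b \<in> carrier G \<Longrightarrow> p \<in> P \<Longrightarrow> act (a \<otimes> b) p = act a (act b p)"
    and tr_closed: "a \<in> carrier G \<Longrightarrow> p \<in> P \<Longrightarrow> x \<in> X0 \<Longrightarrow> tr a p x \<in> X0"
    and tr_one: "p \<in> P \<Longrightarrow> x \<in> X0 \<Longrightarrow> tr \<one> p x = x"
    and tr_mult: "a \<in> carrier G \<Longrightarrow> b \<in> carrier G \<Longrightarrow> p \<in> P \<Longrightarrow> x \<in> X0 \<Longrightarrow>
          tr (a \<otimes> b) p x = tr a (act b p) (tr b p x)"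
    and x0: "x0 \<in> X0"
    and almost_flat: "a \<in> carrier G \<Longrightarrow> finite {p \<in> P. tr a p x0 \<noteq> x0}"
begin

abbreviation "flt \<equiv> flat act tr"
abbreviation "sect \<equiv> finite_section P X0 x0"
abbreviation "Fixp \<equiv> common_fixpoints P act"

lemma sect_in: "sect y \<Longrightarrow> p \<in> P \<Longrightarrow> y p \<in> X0"
  by (simp add: finite_section_def)

lemma act_inv: "a \<in> carrier G \<Longrightarrow> p \<in> P \<Longrightarrow> act (inv a) (act a p) = p"
  using act_mult[of "inv a" a p] act_one by simp

lemma act_inv': "a \<in> carrier G \<Longrightarrow> p \<in> P \<Longrightarrow> act a (act (inv a) p) = p"
  using act_mult[of a "inv a" p] act_one by simp

lemma act_inj: "a \<in> carrier G \<Longrightarrow> p \<in> P \<Longrightarrow> q \<in> P \<Longrightarrow> act a p = act a q \<Longrightarrow> p = q"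
  by (metis act_inv)

lemma tr_inj:
  assumes "a \<in> carrier G" "p \<in> P" "x \<in> X0" "y \<in> X0" "tr a p x = tr a p y"
  shows "x = y"
  using tr_mult[of "inv a" a p x] tr_mult[of "inv a" a p y] assms tr_one by simp

lemma flat_one: "sect y \<Longrightarrow> p \<in> P \<Longrightarrow> flt \<one> y p"
  by (simp add: flat_def tr_one act_one sect_in)

lemma flat_mult:
  assumes "sect y" "a \<in> carrier G" "b \<in> carrier G" "p \<in> P" "flt b y p" "flt a y (act b p)"
  shows "flt (a \<otimes> b) y p"
  using assms by (simp add: flat_def tr_mult act_mult sect_in)

lemma flat_mult_left:
  assumes "sect y" "a \<in> carrier G" "b \<in> carrier G" "p \<in> P" "flt (a \<otimes> b) y p" "flt b y p"
  shows "flt a y (act b p)"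
  using assms by (simp add: flat_def tr_mult act_mult sect_in)

lemma flat_mult_right:
  assumes "sect y" "a \<in> carrier G" "b \<in> carrier G" "p \<in> P" "flt (a \<otimes> b) y p" "flt a y (act b p)"
  shows "flt b y p"
proof -
  have "tr a (act b p) (tr b p (y p)) = tr a (act b p) (y (act b p))"
    using assms by (simp add: flat_def tr_mult act_mult sect_in)
  then have "tr b p (y p) = y (act b p)"
    using tr_inj[of a "act b p"] assms by (simp add: act_closed tr_closed sect_in)
  then show ?thesis by (simp add: flat_def)
qed

lemma flat_inv:
  assumes "sect y" "a \<in> carrier G" "p \<in> P" "flt a y p"
  shows "flt (inv a) y (act a p)"
  using assms flat_mult_left[of y "inv a" a p] flat_one by simp

text \<open>Two sections agree almost everywhere and the constant section is almost flat, so every section is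
flat for \<open>a\<close> at almost every index. This finiteness drives all arguments on infinite orbits.\<close>

lemma finite_defects:
  assumes y: "sect y" and a: "a \<in> carrier G"
  shows "finite {p \<in> P. \<not> flt a y p}"
proof (rule finite_subset)
  let ?Y = "{p \<in> P. y p \<noteq> x0}"
  show "{p \<in> P. \<not> flt a y p} \<subseteq> ?Y \<union> {p \<in> P. tr a p x0 \<noteq> x0} \<union> act (inv a) ` ?Y"
  proof
    fix p assume p: "p \<in> {p \<in> P. \<not> flt a y p}"
    show "p \<in> ?Y \<union> {p \<in> P. tr a p x0 \<noteq> x0} \<union> act (inv a) ` ?Y"
    proof (rule ccontr)
      assume n: "p \<notin> ?Y \<union> {p \<in> P. tr a p x0 \<noteq> x0} \<union> act (inv a) ` ?Y"
      have "act a p \<notin> ?Y"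
      proof
        assume "act a p \<in> ?Y"
        then have "act (inv a) (act a p) \<in> act (inv a) ` ?Y" by (rule imageI)
        then show False using n p a by (simp add: act_inv)
      qed
      then have "y (act a p) = x0" using p a act_closed by simp
      then show False using n p by (simp add: flat_def)
    qed
  qed
  show "finite (?Y \<union> {p \<in> P. tr a p x0 \<noteq> x0} \<union> act (inv a) ` ?Y)"
    using y almost_flat[OF a] by (simp add: finite_section_def)
qed

lemma flat_subgroup:
  assumes "sect y"
  shows "subgroup {a \<in> carrier G. \<forall>p\<in>P. flt a y p} G"
proof (rule subgroupI)
  show "{a \<in> carrier G. \<forall>p\<in>P. flt a y p} \<noteq> {}" using flat_one[OF assms] by blast
next
  fix a assume a: "a \<in> {a \<in> carrier G. \<forall>p\<in>P. flt a y p}"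
  have "flt (inv a) y p" if "p \<in> P" for p
    using flat_inv[OF assms, of a "act (inv a) p"] a that act_closed act_inv' by simp
  then show "inv a \<in> {a \<in> carrier G. \<forall>p\<in>P. flt a y p}" using a by simp
next
  fix a b assume "a \<in> {a \<in> carrier G. \<forall>p\<in>P. flt a y p}" "b \<in> {a \<in> carrier G. \<forall>p\<in>P. flt a y p}"
  then show "a \<otimes> b \<in> {a \<in> carrier G. \<forall>p\<in>P. flt a y p}"
    using flat_mult[OF assms] act_closed by simp
qed auto

lemma flat_int_pow:
  assumes "sect y" "c \<in> carrier G" "\<forall>p\<in>P. flt c y p" "p \<in> P"
  shows "flt (c [^] (i::int)) y p"
  using subgroup_int_pow_closed[OF flat_subgroup[OF assms(1)], of c i] assms by simp

lemma act_pow_add: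
  "c \<in> carrier G \<Longrightarrow> p \<in> P \<Longrightarrow> act (c [^] (i + j::int)) p = act (c [^] i) (act (c [^] j) p)"
  by (simp add: int_pow_mult act_mult)

lemma act_pow_Suc:
  assumes "c \<in> carrier G" "p \<in> P"
  shows "act (c [^] (i + 1::int)) p = act c (act (c [^] i) p)"
  using act_pow_add[of c p 1 i] assms by (simp add: add.commute)

text \<open>The orbit of \<open>p\<close> under the powers of \<open>c\<close> is infinite; integer exponents make the orbit a two-sided
sequence.\<close>

definition free_at where
  "free_at c p \<longleftrightarrow> (\<forall>i::int. i \<noteq> 0 \<longrightarrow> act (c [^] i) p \<noteq> p)"

lemma free_at_inj:
  assumes "c \<in> carrier G" "p \<in> P" "free_at c p"
  shows "inj (\<lambda>i::int. act (c [^] i) p)"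
proof (rule injI)
  fix i j :: int assume e: "act (c [^] i) p = act (c [^] j) p"
  have "act (c [^] (i - j)) p = act (c [^] (- j)) (act (c [^] i) p)"
    using act_pow_add[of c p "- j" i] assms by simp
  also have "\<dots> = act (c [^] (- j)) (act (c [^] j) p)" using e by simp
  also have "\<dots> = p" using act_pow_add[of c p "- j" j] assms act_one by simp
  finally have "i - j = 0" using assms(3) unfolding free_at_def by blast
  then show "i = j" by simp
qed

lemma free_at_escape:
  assumes c: "c \<in> carrier G" and F: "finite F" "F \<subseteq> P" "\<And>q. q \<in> F \<Longrightarrow> free_at c q" and D: "finite D"
  shows "\<exists>m::nat. \<forall>i::int. \<bar>i\<bar> \<ge> int m \<longrightarrow> (\<forall>q\<in>F. act (c [^] i) q \<notin> D)"
proof -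
  have "finite {i::int. act (c [^] i) q \<in> D}" if "q \<in> F" for q
    using finite_vimageI[OF D free_at_inj[OF c]] that F by (auto simp: vimage_def)
  then have "finite (\<Union>q\<in>F. {i::int. act (c [^] i) q \<in> D})" using F(1) by blast
  then have fin: "finite (abs ` (\<Union>q\<in>F. {i::int. act (c [^] i) q \<in> D}))" by blast
  define k where "k = Max (insert 0 (abs ` (\<Union>q\<in>F. {i::int. act (c [^] i) q \<in> D}))) + 1"
  have k: "i < k" if "i \<in> abs ` (\<Union>q\<in>F. {i::int. act (c [^] i) q \<in> D})" for i
    using Max_ge[OF finite.insertI[OF fin, of 0], of i] that unfolding k_def by simp
  show ?thesis
  proof (intro exI[of _ "nat k"] allI impI ballI notI)
    fix i :: int and q assume i: "int (nat k) \<le> \<bar>i\<bar>" and q: "q \<in> F" "act (c [^] i) q \<in> D"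
    have "i \<in> (\<Union>q\<in>F. {i::int. act (c [^] i) q \<in> D})" using q by blast
    then have "\<bar>i\<bar> < k" by (intro k imageI)
    then show False using i by linarith
  qed
qed

text \<open>A section known on \<open>I\<close> spreads over all \<open>K\<close>-translates of \<open>I\<close> if it is flat for \<open>K\<close> wherever
both ends of the transport lie in \<open>I\<close>. Finitely many translates must suffice to cover the rest,
since otherwise the spread section need not agree with \<open>x0\<close> almost everywhere.\<close>

lemma glue:
  assumes K: "subgroup K G" and I: "I \<subseteq> P" and b: "sect b"
    and coh: "\<And>a p. a \<in> K \<Longrightarrow> p \<in> I \<Longrightarrow> act a p \<in> I \<Longrightarrow> flt a b p"
    and T: "finite T" "T \<subseteq> K" "\<And>a p. a \<in> K \<Longrightarrow> p \<in> I \<Longrightarrow> \<exists>t\<in>T. \<exists>q\<in>I. act a p = act t q"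
  shows "\<exists>b'. sect b' \<and> (\<forall>a\<in>K. \<forall>p\<in>I. b' (act a p) = tr a p (b p))"
proof -
  have KG: "a \<in> carrier G" if "a \<in> K" for a using K that by (rule subgroup.mem_carrier)
  have wd: "tr a p (b p) = tr a' p' (b p')"
    if h: "a \<in> K" "p \<in> I" "a' \<in> K" "p' \<in> I" "act a p = act a' p'" for a p a' p'
  proof -
    have c: "a \<in> carrier G" "a' \<in> carrier G" "p \<in> P" "p' \<in> P" using h KG I by auto
    define k where "k = inv a' \<otimes> a"
    have kK: "k \<in> K" unfolding k_def using h K by (simp add: subgroup.m_inv_closed subgroup.m_closed)
    have kp: "act k p = p'" unfolding k_def using c h(5) by (simp add: act_mult act_inv)
    have "tr k p (b p) = b p'" using coh[OF kK h(2)] kp h(4) by (simp add: flat_def)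
    moreover have "a = a' \<otimes> k" unfolding k_def using c by (simp add: cancel_inv_left)
    ultimately show ?thesis using tr_mult[of a' k p "b p"] kp KG[OF kK] c b by (simp add: sect_in)
  qed
  define b' where "b' q = (if \<exists>a\<in>K. \<exists>p\<in>I. q = act a p
      then (SOME x. \<exists>a\<in>K. \<exists>p\<in>I. q = act a p \<and> x = tr a p (b p)) else x0)" for q
  have b'eq: "b' (act a p) = tr a p (b p)" if h: "a \<in> K" "p \<in> I" for a p
  proof -
    let ?R = "\<lambda>x. \<exists>a'\<in>K. \<exists>p'\<in>I. act a p = act a' p' \<and> x = tr a' p' (b p')"
    have "\<exists>x. ?R x" using h by blast
    from someI_ex[OF this] obtain a' p' where
      s: "a' \<in> K" "p' \<in> I" "act a p = act a' p'" "(SOME x. ?R x) = tr a' p' (b p')" by blast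
    have "b' (act a p) = (SOME x. ?R x)" unfolding b'_def using h by (intro if_P) blast
    then show ?thesis using wd[OF h s(1-3)] s(4) by simp
  qed
  have b'x0: "b' q = x0" if "\<not> (\<exists>a\<in>K. \<exists>p\<in>I. q = act a p)" for q
    unfolding b'_def using that by simp
  have in0: "b' q \<in> X0" for q
  proof (cases "\<exists>a\<in>K. \<exists>p\<in>I. q = act a p")
    case True
    then obtain a p where ap: "a \<in> K" "p \<in> I" "q = act a p" by blast
    then have "p \<in> P" "a \<in> carrier G" using I KG by auto
    then show ?thesis using b'eq[OF ap(1,2)] ap(3) tr_closed sect_in[OF b] by simp
  qed (simp add: b'x0 x0)
  have fin: "finite {p \<in> P. tr t p (b p) \<noteq> x0}" if t: "t \<in> T" for t
  proof (rule finite_subset)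
    show "{p \<in> P. tr t p (b p) \<noteq> x0} \<subseteq> {p \<in> P. b p \<noteq> x0} \<union> {p \<in> P. tr t p x0 \<noteq> x0}" by auto
    show "finite ({p \<in> P. b p \<noteq> x0} \<union> {p \<in> P. tr t p x0 \<noteq> x0})"
      using b almost_flat KG T(2) t by (auto simp: finite_section_def)
  qed
  have "{q \<in> P. b' q \<noteq> x0} \<subseteq> (\<Union>t\<in>T. act t ` {p \<in> P. tr t p (b p) \<noteq> x0})"
  proof
    fix q assume q: "q \<in> {q \<in> P. b' q \<noteq> x0}"
    then obtain a p where "a \<in> K" "p \<in> I" "q = act a p" using b'x0 by blast
    then obtain t p' where t: "t \<in> T" "p' \<in> I" "q = act t p'" using T(3) by metis
    then have "b' q = tr t p' (b p')" using b'eq T(2) by blast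
    then show "q \<in> (\<Union>t\<in>T. act t ` {p \<in> P. tr t p (b p) \<noteq> x0})" using q t I by auto
  qed
  moreover have "finite (\<Union>t\<in>T. act t ` {p \<in> P. tr t p (b p) \<noteq> x0})" using T(1) fin by blast
  ultimately have "finite {q \<in> P. b' q \<noteq> x0}" by (rule finite_subset)
  then have "sect b'" unfolding finite_section_def using in0 by blast
  then show ?thesis using b'eq by blast
qed

lemma glued_flat:
  assumes K: "subgroup K G" and I: "I \<subseteq> P" and b: "sect b"
    and eq: "\<forall>a\<in>K. \<forall>p\<in>I. b' (act a p) = tr a p (b p)"
    and h: "a \<in> K" "g \<in> K" "p \<in> I"
  shows "flt a b' (act g p)"
proof -
  have c: "a \<in> carrier G" "g \<in> carrier G" "p \<in> P" using h K I subgroup.mem_carrier by auto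
  have "b' (act (a \<otimes> g) p) = tr (a \<otimes> g) p (b p)" using eq h K by (simp add: subgroup.m_closed)
  then show ?thesis using eq h c b by (simp add: flat_def act_mult tr_mult sect_in)
qed

text \<open>The stabiliser of an index has finite index, so it is finitely generated. Evaluating the sections
fixed by its elements at \<open>p\<close> shows that it acts purely elliptically on the fibre over \<open>p\<close>, hence it
fixes a point there. Transporting this point around the orbit is unambiguous.\<close>

lemma finite_orbit_fixed_section:
  assumes fg: "finitely_generated G" and fin: "finite P"
    and trans: "\<And>p q. p \<in> P \<Longrightarrow> q \<in> P \<Longrightarrow> \<exists>a\<in>carrier G. act a p = q"
    and ell: "\<And>a. a \<in> carrier G \<Longrightarrow> \<exists>y. sect y \<and> (\<forall>p\<in>P. flt a y p)"
    and decent: "\<And>p Y. p \<in> P \<Longrightarrow> finite Y \<Longrightarrow> generate G Y \<subseteq> {a \<in> carrier G. act a p = p} \<Longrightarrow>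
        Y \<subseteq> carrier G \<Longrightarrow>
        (\<And>a. a \<in> generate G Y \<Longrightarrow> \<exists>x\<in>X0. tr a p x = x) \<Longrightarrow> \<exists>x\<in>X0. \<forall>a\<in>generate G Y. tr a p x = x"
  shows "\<exists>y. sect y \<and> (\<forall>a\<in>carrier G. \<forall>p\<in>P. flt a y p)"
proof (cases "P = {}")
  case True
  then show ?thesis using ell[OF one_closed] by auto
next
  case False
  then obtain p where p: "p \<in> P" by blast
  let ?K = "{a \<in> carrier G. act a p = p}"
  have K: "subgroup ?K G"
  proof (rule subgroupI)
    show "?K \<noteq> {}" using act_one[OF p] by blast
    fix a assume "a \<in> ?K" then show "inv a \<in> ?K" using act_inv[of a p] p by auto
  next
    fix a b assume "a \<in> ?K" "b \<in> ?K" then show "a \<otimes> b \<in> ?K" using act_mult[of a b p] p by auto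
  qed auto
  have "finite_index G ?K"
  proof (rule finite_index_by_invariant[where f = "\<lambda>a. act (inv a) p"])
    have "(\<lambda>a. act (inv a) p) ` carrier G \<subseteq> P" using act_closed p by auto
    then show "finite ((\<lambda>a. act (inv a) p) ` carrier G)" using fin finite_subset by blast
    fix a b assume "a \<in> carrier G" "b \<in> carrier G" "act (inv a) p = act (inv b) p"
    then show "a \<otimes> inv b \<in> ?K" using p by (simp add: act_mult) (metis act_inv')
  qed
  then obtain Y where Y: "finite Y" "Y \<subseteq> ?K" "generate G Y = ?K"
    using finitely_generated_if_finite_index[OF fg K] by blast
  have "\<exists>x\<in>X0. \<forall>a\<in>generate G Y. tr a p x = x"
  proof (rule decent[OF p Y(1)])
    show "generate G Y \<subseteq> ?K" using Y(3) by simp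
    show "Y \<subseteq> carrier G" using Y(2) by blast
    fix a assume "a \<in> generate G Y"
    then have a: "a \<in> carrier G" "act a p = p" using Y(3) by auto
    obtain y where "sect y" "\<forall>p\<in>P. flt a y p" using ell[OF a(1)] by blast
    then show "\<exists>x\<in>X0. tr a p x = x"
      using p a(2) sect_in[of y p] by (intro bexI[of _ "y p"]) (auto simp: flat_def)
  qed
  then obtain x where x: "x \<in> X0" "\<And>a. a \<in> carrier G \<Longrightarrow> act a p = p \<Longrightarrow> tr a p x = x"
    using Y(3) by auto
  have sx: "sect (\<lambda>_. x)" using x(1) fin by (simp add: finite_section_def)
  have "\<forall>q\<in>P. \<exists>a\<in>carrier G. act a p = q" using trans[OF p] by blast
  then obtain r where r: "\<And>q. q \<in> P \<Longrightarrow> r q \<in> carrier G \<and> act (r q) p = q" by metis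
  have "\<exists>b'. sect b' \<and> (\<forall>a\<in>carrier G. \<forall>q\<in>{p}. b' (act a q) = tr a q ((\<lambda>_. x) q))"
  proof (rule glue[OF subgroup_self _ sx, where T = "r ` P"])
    show "{p} \<subseteq> P" using p by simp
    show "finite (r ` P)" using fin by simp
    show "r ` P \<subseteq> carrier G" using r by blast
    fix a q assume a: "a \<in> carrier G" and q: "q \<in> {p}"
    show "flt a (\<lambda>_. x) q" if "act a q \<in> {p}" using x(2)[OF a] q that by (simp add: flat_def)
    show "\<exists>t\<in>r ` P. \<exists>q'\<in>{p}. act a q = act t q'"
      using r[of "act a p"] act_closed[OF a p] q by (intro bexI[of _ "r (act a p)"]) auto
  qed
  then obtain y where y: "sect y" "\<forall>a\<in>carrier G. \<forall>q\<in>{p}. y (act a q) = tr a q x" by blast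
  have "flt a y q" if "a \<in> carrier G" "q \<in> P" for a q
    using glued_flat[OF subgroup_self _ sx y(2), of a "r q" p] r[OF that(2)] that p by simp
  then show ?thesis using y(1) by blast
qed

end

section \<open>Bounded chains of fixed point sets\<close>

text \<open>A bounded, strictly monotone rank bounds the length of chains of common fixed point sets in both
directions. This is all that is used of the geometry of the projective plane.\<close>

definition bounded_fixpoint_chains :: "'p set \<Rightarrow> ('a \<Rightarrow> 'p \<Rightarrow> 'p) \<Rightarrow> 'a set \<Rightarrow> bool" where
  "bounded_fixpoint_chains P act A \<longleftrightarrow>
     (\<exists>(rk :: 'p set \<Rightarrow> nat) N. \<forall>S\<subseteq>A. \<forall>S'\<subseteq>A.
        rk (common_fixpoints P act S) \<le> N \<and>
        (common_fixpoints P act S \<subset> common_fixpoints P act S' \<longrightarrow>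
         rk (common_fixpoints P act S) < rk (common_fixpoints P act S')))"

locale elliptic_bundle = bundle_action +
  assumes trans: "p \<in> P \<Longrightarrow> q \<in> P \<Longrightarrow> \<exists>a\<in>carrier G. act a p = q"
    and elliptic: "a \<in> carrier G \<Longrightarrow> \<exists>y. finite_section P X0 x0 y \<and> (\<forall>p\<in>P. flat act tr a y p)"
    and chains: "bounded_fixpoint_chains P act (carrier G)"
begin

lemma rank:
  obtains rk :: "'c set \<Rightarrow> nat" and N where
    "\<And>S. S \<subseteq> carrier G \<Longrightarrow> rk (Fixp S) \<le> N"
    "\<And>S S'. S \<subseteq> carrier G \<Longrightarrow> S' \<subseteq> carrier G \<Longrightarrow> Fixp S \<subset> Fixp S' \<Longrightarrow> rk (Fixp S) < rk (Fixp S')"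
  using chains unfolding bounded_fixpoint_chains_def by (metis (no_types, lifting))

text \<open>Take a finite subset of \<open>S\<close> whose common fixed point set has least rank.\<close>

lemma finite_fixpoint_basis:
  assumes "S \<subseteq> carrier G"
  shows "\<exists>T\<subseteq>S. finite T \<and> Fixp T = Fixp S"
proof -
  obtain rk :: "'c set \<Rightarrow> nat" and N where
    r: "\<And>S S'. S \<subseteq> carrier G \<Longrightarrow> S' \<subseteq> carrier G \<Longrightarrow> Fixp S \<subset> Fixp S' \<Longrightarrow> rk (Fixp S) < rk (Fixp S')"
    using rank by metis
  have "\<exists>T. (T \<subseteq> S \<and> finite T) \<and> (\<forall>T'. T' \<subseteq> S \<and> finite T' \<longrightarrow> rk (Fixp T) \<le> rk (Fixp T'))"
    by (rule ex_has_least_nat[of "\<lambda>T. T \<subseteq> S \<and> finite T" "{}" "\<lambda>T. rk (Fixp T)"]) simp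
  then obtain T where
    T: "T \<subseteq> S" "finite T" "\<And>T'. T' \<subseteq> S \<Longrightarrow> finite T' \<Longrightarrow> rk (Fixp T) \<le> rk (Fixp T')"
    by blast
  have "p \<in> Fixp S" if p: "p \<in> Fixp T" for p
  proof -
    have "act a p = p" if a: "a \<in> S" for a
    proof (rule ccontr)
      assume "act a p \<noteq> p"
      then have "Fixp (insert a T) \<subset> Fixp T" using p by (auto simp: common_fixpoints_def)
      then have "rk (Fixp (insert a T)) < rk (Fixp T)" using a T(1) assms by (intro r) auto
      then show False using T(3)[of "insert a T"] T(1,2) a by simp
    qed
    then show ?thesis using p by (simp add: common_fixpoints_def)
  qed
  moreover have "Fixp S \<subseteq> Fixp T" using T(1) by (auto simp: common_fixpoints_def)
  ultimately show ?thesis using T(1,2) by blast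
qed

text \<open>Take a finite set of indices for which the common fixed points of its pointwise stabiliser in \<open>C\<close>
have largest rank; adding a further index cannot enlarge them, so they are all of \<open>P\<close>.\<close>

lemma finite_determining_set:
  assumes C: "C \<subseteq> carrier G"
  shows "\<exists>S\<subseteq>P. finite S \<and> (\<forall>a\<in>C. (\<forall>p\<in>S. act a p = p) \<longrightarrow> (\<forall>p\<in>P. act a p = p))"
proof -
  obtain rk :: "'c set \<Rightarrow> nat" and N where
    r: "\<And>S. S \<subseteq> carrier G \<Longrightarrow> rk (Fixp S) \<le> N"
    "\<And>S S'. S \<subseteq> carrier G \<Longrightarrow> S' \<subseteq> carrier G \<Longrightarrow> Fixp S \<subset> Fixp S' \<Longrightarrow> rk (Fixp S) < rk (Fixp S')"
    using rank by metis
  define St where "St S = {a \<in> C. \<forall>p\<in>S. act a p = p}" for S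
  have StG: "St S \<subseteq> carrier G" for S using C unfolding St_def by blast
  have "\<exists>S. (S \<subseteq> P \<and> finite S) \<and> (\<forall>S'. S' \<subseteq> P \<and> finite S' \<longrightarrow> rk (Fixp (St S')) \<le> rk (Fixp (St S)))"
    by (rule ex_has_greatest_nat[of "\<lambda>S. S \<subseteq> P \<and> finite S" "{}" "\<lambda>S. rk (Fixp (St S))" "Suc N"])
      (use r(1) StG in \<open>auto simp: less_Suc_eq_le\<close>)
  then obtain S where S: "S \<subseteq> P" "finite S"
    "\<And>S'. S' \<subseteq> P \<Longrightarrow> finite S' \<Longrightarrow> rk (Fixp (St S')) \<le> rk (Fixp (St S))" by blast
  have "act a p = p" if a: "a \<in> C" "\<forall>p\<in>S. act a p = p" and p: "p \<in> P" for a p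
  proof (rule ccontr)
    assume n: "act a p \<noteq> p"
    have "Fixp (St S) \<subseteq> Fixp (St (insert p S))" unfolding common_fixpoints_def St_def by auto
    moreover have "p \<in> Fixp (St (insert p S))" using p unfolding common_fixpoints_def St_def by auto
    moreover have "p \<notin> Fixp (St S)" using n a unfolding common_fixpoints_def St_def by auto
    ultimately have "Fixp (St S) \<subset> Fixp (St (insert p S))" by blast
    then have "rk (Fixp (St S)) < rk (Fixp (St (insert p S)))" using StG by (intro r(2)) auto
    then show False using S(3)[of "insert p S"] S(1,2) p by simp
  qed
  then show ?thesis using S(1,2) by blast
qed

lemma act_nat_pow_fix:
  assumes "c \<in> carrier G" "p \<in> P" "act c p = p"
  shows "act (c [^] (n::nat)) p = p"
  using assms by (induct n) (simp_all add: act_one act_mult)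

lemma not_free_at:
  assumes c: "c \<in> carrier G" and p: "p \<in> P" and n: "\<not> free_at c p"
  shows "\<exists>j>0. act (c [^] (j::nat)) p = p"
proof -
  obtain i :: int where i: "i \<noteq> 0" "act (c [^] i) p = p" using n unfolding free_at_def by blast
  have "act (c [^] (- i)) p = act (c [^] (- i)) (act (c [^] i) p)" using i(2) by simp
  also have "\<dots> = p" using act_pow_add[OF c p, of "- i" i] act_one[OF p] by simp
  finally have "act (c [^] \<bar>i\<bar>) p = p" using i(2) by (simp add: abs_if)
  then have "act (c [^] nat \<bar>i\<bar>) p = p" using int_pow_int[of G c "nat \<bar>i\<bar>"] by simp
  then show ?thesis using i(1) by (intro exI[of _ "nat \<bar>i\<bar>"]) simp
qed

text \<open>The fixed points of a power of \<open>c\<close> of largest rank already contain all periodic points.\<close>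

lemma power_fixed_or_free:
  assumes c: "c \<in> carrier G"
  shows "\<exists>M>0. \<forall>p\<in>P. act (c [^] (M::nat)) p = p \<or> free_at (c [^] M) p"
proof -
  obtain rk :: "'c set \<Rightarrow> nat" and N where
    r: "\<And>S. S \<subseteq> carrier G \<Longrightarrow> rk (Fixp S) \<le> N"
    "\<And>S S'. S \<subseteq> carrier G \<Longrightarrow> S' \<subseteq> carrier G \<Longrightarrow> Fixp S \<subset> Fixp S' \<Longrightarrow> rk (Fixp S) < rk (Fixp S')"
    using rank by metis
  have "\<exists>M. (M::nat) > 0 \<and> (\<forall>M'::nat. M' > 0 \<longrightarrow> rk (Fixp {c [^] M'}) \<le> rk (Fixp {c [^] M}))"
    by (rule ex_has_greatest_nat[of "\<lambda>M::nat. 0 < M" 1 "\<lambda>M. rk (Fixp {c [^] M})" "Suc N"])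
      (use r(1) c in \<open>auto simp: less_Suc_eq_le\<close>)
  then obtain M :: nat where M: "M > 0" "\<And>M'::nat. M' > 0 \<Longrightarrow> rk (Fixp {c [^] M'}) \<le> rk (Fixp {c [^] M})"
    by blast
  have "act (c [^] M) p = p" if p: "p \<in> P" and nf: "\<not> free_at (c [^] M) p" for p
  proof (rule ccontr)
    assume n: "act (c [^] M) p \<noteq> p"
    obtain j :: nat where j: "j > 0" "act ((c [^] M) [^] j) p = p" using not_free_at[OF _ p nf] c by auto
    have jm: "(c [^] M) [^] j = c [^] (M * j)" using c by (simp add: nat_pow_pow)
    have "Fixp {c [^] M} \<subseteq> Fixp {c [^] (M * j)}"
      using act_nat_pow_fix[of "c [^] M" _ j] c jm by (auto simp: common_fixpoints_def)
    moreover have "p \<in> Fixp {c [^] (M * j)}" "p \<notin> Fixp {c [^] M}"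
      using j(2) jm n p by (auto simp: common_fixpoints_def)
    ultimately have "Fixp {c [^] M} \<subset> Fixp {c [^] (M * j)}" by blast
    then have "rk (Fixp {c [^] M}) < rk (Fixp {c [^] (M * j)})" using r(2) c by simp
    then show False using M(2)[of "M * j"] M(1) j(1) by simp
  qed
  then show ?thesis using M(1) by blast
qed

text \<open>Infinite orbits contain more than \<open>n\<close> points each; the chain condition makes one finite set \<open>E\<close>
achieve this for all of them. Noetherian induction on a common fixed point set \<open>Fixp S\<close>: the
elements of \<open>B\<close> that move one of its points \<open>q\<close> to \<open>n + 1\<close> different places do so for every other
point of \<open>Fixp S\<close>, apart from those fixed by one of finitely many additional elements, and each of
these exceptional sets is smaller because it misses \<open>q\<close>.\<close>

lemma uniformly_large_orbits:
  assumes B: "subgroup B G" and inf: "\<And>p. p \<in> P \<Longrightarrow> infinite ((\<lambda>a. act a p) ` B)"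
  shows "\<exists>E\<subseteq>B. finite E \<and> (\<forall>q\<in>P. n < card ((\<lambda>a. act a q) ` E))"
proof -
  obtain rk :: "'c set \<Rightarrow> nat" and N where
    r: "\<And>S S'. S \<subseteq> carrier G \<Longrightarrow> S' \<subseteq> carrier G \<Longrightarrow> Fixp S \<subset> Fixp S' \<Longrightarrow> rk (Fixp S) < rk (Fixp S')"
    using rank by metis
  have BG: "B \<subseteq> carrier G" using B by (rule subgroup.subset)
  have "\<exists>E\<subseteq>B. finite E \<and> (\<forall>q\<in>Fixp S. n < card ((\<lambda>a. act a q) ` E))" if "S \<subseteq> carrier G" for S
    using that
  proof (induct "rk (Fixp S)" arbitrary: S rule: less_induct)
    case less
    show ?case
    proof (cases "Fixp S = {}")
      case True
      then show ?thesis by (intro exI[of _ "{}"]) simp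
    next
      case False
      then obtain q where q: "q \<in> Fixp S" by blast
      have qP: "q \<in> P" using q by (simp add: common_fixpoints_def)
      obtain F where F: "F \<subseteq> (\<lambda>a. act a q) ` B" "card F = Suc n" "finite F"
        using infinite_arbitrarily_large[OF inf[OF qP]] by blast
      obtain E0 where E0: "E0 \<subseteq> B" "inj_on (\<lambda>a. act a q) E0" "F = (\<lambda>a. act a q) ` E0"
        using F(1) unfolding subset_image_inj by blast
      have cE0: "card E0 = Suc n" "finite E0" using F E0 card_image finite_image_iff by metis+
      let ?J = "{(e, e'). e \<in> E0 \<and> e' \<in> E0 \<and> e \<noteq> e'}"
      have "\<forall>j\<in>?J. \<exists>E. E \<subseteq> B \<and> finite E \<and>
          (\<forall>z\<in>Fixp (insert (inv (fst j) \<otimes> snd j) S). n < card ((\<lambda>a. act a z) ` E))"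
      proof
        fix j assume "j \<in> ?J"
        then obtain e e' where e: "j = (e, e')" "e \<in> E0" "e' \<in> E0" "e \<noteq> e'" by blast
        have c: "e \<in> carrier G" "e' \<in> carrier G" using e E0(1) BG by auto
        have "act e q \<noteq> act e' q" using e E0(2) by (meson inj_onD)
        then have "act (inv e \<otimes> e') q \<noteq> q"
          using c qP act_inv'[of e "act e' q"] act_closed[of e' q] by (auto simp: act_mult)
        then have "Fixp (insert (inv e \<otimes> e') S) \<subset> Fixp S" using q by (auto simp: common_fixpoints_def)
        moreover have "insert (inv e \<otimes> e') S \<subseteq> carrier G" using c less.prems by simp
        ultimately have "\<exists>E\<subseteq>B. finite E \<and> (\<forall>z\<in>Fixp (insert (inv e \<otimes> e') S). n < card ((\<lambda>a. act a z) ` E))"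
          by (intro less.hyps r less.prems)
        then show "\<exists>E. E \<subseteq> B \<and> finite E \<and>
          (\<forall>z\<in>Fixp (insert (inv (fst j) \<otimes> snd j) S). n < card ((\<lambda>a. act a z) ` E))"
          unfolding e(1) fst_conv snd_conv by blast
      qed
      from bchoice[OF this] obtain Ej where Ej: "\<forall>j\<in>?J. Ej j \<subseteq> B \<and> finite (Ej j) \<and>
          (\<forall>z\<in>Fixp (insert (inv (fst j) \<otimes> snd j) S). n < card ((\<lambda>a. act a z) ` Ej j))"
        by blast
      define E where "E = E0 \<union> (\<Union>j\<in>?J. Ej j)"
      have "finite ?J" using finite_subset[of ?J "E0 \<times> E0"] cE0(2) by auto
      then have finE: "finite E" unfolding E_def using cE0(2) Ej by blast
      have EB: "E \<subseteq> B" unfolding E_def using E0(1) Ej by blast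
      have "n < card ((\<lambda>a. act a z) ` E)" if z: "z \<in> Fixp S" for z
      proof (cases "inj_on (\<lambda>a. act a z) E0")
        case True
        then have "Suc n = card ((\<lambda>a. act a z) ` E0)" using cE0 by (simp add: card_image)
        also have "\<dots> \<le> card ((\<lambda>a. act a z) ` E)" using finE unfolding E_def by (intro card_mono) auto
        finally show ?thesis by simp
      next
        case False
        then obtain e e' where e: "e \<in> E0" "e' \<in> E0" "e \<noteq> e'" "act e z = act e' z"
          unfolding inj_on_def by blast
        have zP: "z \<in> P" using z by (simp add: common_fixpoints_def)
        have c: "e \<in> carrier G" "e' \<in> carrier G" using e E0(1) BG by auto
        have "act (inv e \<otimes> e') z = z" using c zP e(4) by (metis act_inv act_mult inv_closed)
        then have "z \<in> Fixp (insert (inv e \<otimes> e') S)" using z by (simp add: common_fixpoints_def)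
        then have "n < card ((\<lambda>a. act a z) ` Ej (e, e'))" using Ej[rule_format, of "(e, e')"] e by simp
        also have "\<dots> \<le> card ((\<lambda>a. act a z) ` E)"
          using finE e unfolding E_def by (intro card_mono finite_imageI image_mono) auto
        finally show ?thesis .
      qed
      then show ?thesis using finE EB by blast
    qed
  qed
  from this[of "{}"] show ?thesis by (simp add: common_fixpoints_def)
qed

text \<open>On an infinite orbit of \<open>c\<close>, compare \<open>b\<close> with a section \<open>y\<close> fixed by \<open>c\<close>. Both equal \<open>x0\<close> far out in
either direction. Transporting the agreement inwards from both ends shows that they agree on both
sides of the only place where \<open>b\<close> may fail to be flat, so it does not fail there.\<close>

lemma single_defect:
  assumes c: "c \<in> carrier G" and p: "p \<in> P" and free: "free_at c p" and b: "sect b"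
    and fl: "\<And>i::int. i \<noteq> 0 \<Longrightarrow> flt c b (act (c [^] i) p)"
  shows "flt c b p"
proof -
  obtain y where y: "sect y" "\<forall>p\<in>P. flt c y p" using elliptic[OF c] by blast
  let ?p = "\<lambda>i::int. act (c [^] i) p"
  let ?Q = "\<lambda>i. y (?p i) = b (?p i)"
  have pP: "?p i \<in> P" for i using c p act_closed by simp
  have "{i. \<not> ?Q i} \<subseteq> ?p -` ({q \<in> P. y q \<noteq> x0} \<union> {q \<in> P. b q \<noteq> x0})" using pP by fastforce
  moreover have "finite (?p -` ({q \<in> P. y q \<noteq> x0} \<union> {q \<in> P. b q \<noteq> x0}))"
    using y(1) b free_at_inj[OF c p free] by (intro finite_vimageI) (auto simp: finite_section_def)
  ultimately have fin: "finite {i. \<not> ?Q i}" by (rule finite_subset)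
  have yf: "tr c (?p i) (y (?p i)) = y (?p (i + 1))" for i
    using y(2) pP[of i] act_pow_Suc[OF c p, of i] by (simp add: flat_def)
  have bf: "tr c (?p i) (b (?p i)) = b (?p (i + 1))" if "i \<noteq> 0" for i
    using fl[OF that] act_pow_Suc[OF c p, of i] by (simp add: flat_def)
  have "?Q 1"
  proof (rule int_descend[OF fin])
    fix i :: int assume i: "1 \<le> i" "?Q (i + 1)"
    then have "tr c (?p i) (y (?p i)) = tr c (?p i) (b (?p i))" using yf[of i] bf[of i] by simp
    then show "?Q i" using tr_inj[OF c pP[of i]] sect_in[OF y(1) pP[of i]] sect_in[OF b pP[of i]] by blast
  qed
  moreover have "?Q 0"
  proof (rule int_ascend[OF fin])
    fix i :: int assume i: "i < 0" "?Q i"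
    then show "?Q (i + 1)" using yf[of i] bf[of i] by simp
  qed
  ultimately show ?thesis using yf[of 0] c p act_one by (simp add: flat_def)
qed

end

section \<open>Flatness of a section fixed by one element\<close>

text \<open>Throughout, \<open>b\<close> is a section fixed by \<open>c\<close>, and \<open>c\<close> has been replaced by a power for which every
index is either fixed or has an infinite orbit. On the indices of the second kind \<open>b\<close> is forced by
its values far away, and it is shown to be flat for other elements than \<open>c\<close> there.\<close>

locale periodic_section = elliptic_bundle +
  fixes c and b
  assumes c: "c \<in> carrier G" and b: "finite_section P X0 x0 b"
    and cb: "\<forall>p\<in>P. flat act tr c b p"
    and fixed_or_free: "p \<in> P \<Longrightarrow> act c p = p \<or> bundle_action.free_at G act c p"
begin

definition moved where "moved = {p \<in> P. act c p \<noteq> p}"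

lemma movedD: "p \<in> moved \<Longrightarrow> p \<in> P" "p \<in> moved \<Longrightarrow> act c p \<noteq> p"
  by (auto simp: moved_def)

lemma moved_free: "p \<in> moved \<Longrightarrow> free_at c p"
  using fixed_or_free by (auto simp: moved_def)

lemma pow_closed: "p \<in> P \<Longrightarrow> act (c [^] (i::int)) p \<in> P"
  using c by (simp add: act_closed)

lemma act_int_pow_cong:
  assumes u: "u \<in> carrier G" and v: "v \<in> carrier G"
    and eq: "\<And>q. q \<in> P \<Longrightarrow> act u q = act v q" and q: "q \<in> P"
  shows "act (u [^] (i::int)) q = act (v [^] i) q"
proof (induct i rule: int_induct[where k = 0])
  case base
  show ?case by simp
next
  case (step1 i)
  then show ?case using act_pow_Suc[OF u q, of i] act_pow_Suc[OF v q, of i] eq v q act_closed by simp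
next
  case (step2 i)
  have P: "act (u [^] (i - 1)) q \<in> P" "act (v [^] (i - 1)) q \<in> P" using u v q act_closed by simp_all
  have "act u (act (u [^] (i - 1)) q) = act u (act (v [^] (i - 1)) q)"
    using step2(2) act_pow_Suc[OF u q, of "i - 1"] act_pow_Suc[OF v q, of "i - 1"] eq[OF P(2)] by simp
  then show ?case by (rule act_inj[OF u P])
qed

lemma free_at_pow:
  assumes "free_at c p" "m \<noteq> 0"
  shows "free_at (c [^] (m::int)) p"
  using assms c by (simp add: free_at_def int_pow_pow)

lemma commuting_moved:
  assumes k: "k \<in> carrier G" and m: "m \<noteq> 0"
    and comm: "\<And>q. q \<in> P \<Longrightarrow> act (c [^] (m::int)) (act k q) = act k (act (c [^] m) q)"
    and p: "p \<in> moved"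
  shows "act k p \<in> moved"
proof -
  have pP: "p \<in> P" using p by (rule movedD)
  have "act c (act k p) \<noteq> act k p"
  proof
    assume e: "act c (act k p) = act k p"
    have "c \<in> {a \<in> carrier G. act a (act k p) = act k p}" using c e by simp
    moreover have "subgroup {a \<in> carrier G. act a (act k p) = act k p} G"
    proof (rule subgroupI)
      have q: "act k p \<in> P" using k pP by (rule act_closed)
      show "{a \<in> carrier G. act a (act k p) = act k p} \<noteq> {}" using act_one[OF q] by blast
      show "inv a \<in> {a \<in> carrier G. act a (act k p) = act k p}"
        if "a \<in> {a \<in> carrier G. act a (act k p) = act k p}" for a
        using that act_inv[of a, OF _ q] by auto
      show "a \<otimes> a' \<in> {a \<in> carrier G. act a (act k p) = act k p}"
        if "a \<in> {a \<in> carrier G. act a (act k p) = act k p}"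
          "a' \<in> {a \<in> carrier G. act a (act k p) = act k p}" for a a'
        using that act_mult[of a a', OF _ _ q] by auto
    qed auto
    ultimately have "c [^] m \<in> {a \<in> carrier G. act a (act k p) = act k p}"
      using subgroup_int_pow_closed by blast
    then have "act k (act (c [^] m) p) = act k p" using comm[OF pP] by simp
    then have "act (c [^] m) p = p" using act_inj[OF k pow_closed[OF pP] pP] by blast
    then show False using moved_free[OF p] m unfolding free_at_def by blast
  qed
  then show ?thesis using k pP act_closed by (simp add: moved_def)
qed

lemma pow_moved: "p \<in> moved \<Longrightarrow> act (c [^] (i::int)) p \<in> moved"
proof (rule commuting_moved[where m = 1])
  show "c [^] i \<in> carrier G" using c by simp
  fix q assume q: "q \<in> P"
  show "act (c [^] (1::int)) (act (c [^] i) q) = act (c [^] i) (act (c [^] (1::int)) q)"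
    using act_pow_add[OF c q, of 1 i] act_pow_add[OF c q, of i 1] by (simp only: add.commute)
qed auto

text \<open>If \<open>n\<close> acts trivially on the indices, then \<open>n \<otimes> c [^] M\<close> has the same orbits as \<open>c [^] M\<close>. For large
\<open>M\<close> its orbit through \<open>p\<close> avoids all defects of \<open>n\<close> other than \<open>p\<close>, so that \<open>p\<close> would be a single
defect.\<close>

lemma flat_if_trivial:
  assumes n: "n \<in> carrier G" and triv: "\<And>q. q \<in> P \<Longrightarrow> act n q = q" and p: "p \<in> moved"
  shows "flt n b p"
proof -
  have pP: "p \<in> P" using p by (rule movedD)
  obtain m :: nat where m: "\<And>i::int. \<bar>i\<bar> \<ge> int m \<Longrightarrow> act (c [^] i) p \<notin> {q \<in> P. \<not> flt n b q}"
    using free_at_escape[OF c, of "{p}" "{q \<in> P. \<not> flt n b q}"] pP moved_free[OF p]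
      finite_defects[OF b n] by blast
  \<comment> \<open>Adding 1 makes \<open>M\<close> nonzero.\<close>
  define M where "M = int m + 1"
  let ?g = "c [^] M"
  let ?p' = "act (c [^] (- M)) p"
  have g: "?g \<in> carrier G" using c by simp
  have p'P: "?p' \<in> P" using pP by (rule pow_closed)
  have step: "act (n \<otimes> ?g) q = act ?g q" if "q \<in> P" for q
    using that n g triv act_closed by (simp add: act_mult)
  have ng: "n \<otimes> ?g \<in> carrier G" using n g by simp
  have pow: "act ((n \<otimes> ?g) [^] (i::int)) q = act (c [^] (M * i)) q" if q: "q \<in> P" for i q
    using act_int_pow_cong[OF ng g step q, of i] int_pow_pow[OF c] by simp
  have "flt (n \<otimes> ?g) b ?p'"
  proof (rule single_defect[OF _ p'P _ b])
    show "n \<otimes> ?g \<in> carrier G" using n g by simp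
    have "free_at c ?p'" using moved_free[OF pow_moved[OF p]] .
    then show "free_at (n \<otimes> ?g) ?p'"
      using pow[OF p'P] unfolding free_at_def M_def by simp
    fix i :: int assume i: "i \<noteq> 0"
    have e: "act ((n \<otimes> ?g) [^] i) ?p' = act (c [^] (M * i - M)) p"
      using pow[OF p'P] act_pow_add[OF c pP, of "M * i" "- M"] by simp
    have "flt n b (act ?g (act (c [^] (M * i - M)) p))"
    proof -
      have "1 \<le> \<bar>i\<bar>" using i by simp
      then have le: "(int m + 1) * 1 \<le> (int m + 1) * \<bar>i\<bar>" by (intro mult_left_mono) auto
      have "int m \<le> (int m + 1) * 1" by simp
      also note le
      also have "(int m + 1) * \<bar>i\<bar> = \<bar>M * i\<bar>" by (simp add: M_def abs_mult)
      finally have "int m \<le> \<bar>M * i\<bar>" .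
      then have "act (c [^] (M * i)) p \<notin> {q \<in> P. \<not> flt n b q}" by (rule m)
      moreover have "act ?g (act (c [^] (M * i - M)) p) = act (c [^] (M * i)) p"
        using act_pow_add[OF c pP, of M "M * i - M"] by simp
      ultimately show ?thesis using pow_closed[OF pP] by simp
    qed
    then show "flt (n \<otimes> ?g) b (act ((n \<otimes> ?g) [^] i) ?p')"
      unfolding e using flat_mult[OF b n g] flat_int_pow[OF b c cb] pow_closed[OF pP] by blast
  qed
  then have "flt n b (act ?g ?p')"
    using flat_mult_left[OF b n g p'P] flat_int_pow[OF b c cb p'P] by blast
  moreover have "act ?g ?p' = p" using act_pow_add[OF c pP, of M "- M"] act_one[OF pP] by simp
  ultimately show ?thesis by simp
qed

text \<open>The conjugates of \<open>k\<close> by powers of \<open>c\<close> lie in \<open>C\<close>. As permutations of \<open>P\<close> they are determined by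
their values at finitely many indices, and there are only finitely many possible values, so two of
the conjugates act in the same way.\<close>

lemma eventually_commutes:
  assumes C: "C \<lhd> G" and fin: "\<And>p. p \<in> P \<Longrightarrow> finite ((\<lambda>a. act a p) ` C)" and k: "k \<in> C"
  shows "\<exists>r::int. r \<noteq> 0 \<and> (\<forall>q\<in>P. act (c [^] r) (act k q) = act k (act (c [^] r) q))"
proof -
  interpret C: normal C G by (rule C)
  obtain S where S: "S \<subseteq> P" "finite S" "\<And>a. a \<in> C \<Longrightarrow> \<forall>p\<in>S. act a p = p \<Longrightarrow> \<forall>p\<in>P. act a p = p"
    using finite_determining_set[OF C.subset] by blast
  define x where "x i = c [^] i \<otimes> k \<otimes> inv (c [^] i)" for i :: int
  have kG: "k \<in> carrier G" using k by simp
  have ci: "c [^] i \<in> carrier G" for i :: int using c by simp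
  have xC: "x i \<in> C" for i unfolding x_def using C.inv_op_closed2[OF ci k] .
  have xG: "x i \<in> carrier G" for i using xC by simp
  have "range (\<lambda>i. \<lambda>s\<in>S. act (x i) s) \<subseteq> (\<Pi>\<^sub>E s\<in>S. (\<lambda>a. act a s) ` C)" using xC by auto
  moreover have "finite (\<Pi>\<^sub>E s\<in>S. (\<lambda>a. act a s) ` C)" using S fin by (intro finite_PiE) auto
  ultimately have "finite (range (\<lambda>i. \<lambda>s\<in>S. act (x i) s))" by (rule finite_subset)
  then have "\<not> inj (\<lambda>i. \<lambda>s\<in>S. act (x i) s)" using finite_imageD infinite_UNIV_int by blast
  then obtain i j where ij: "i \<noteq> j" "(\<lambda>s\<in>S. act (x i) s) = (\<lambda>s\<in>S. act (x j) s)" unfolding inj_def by blast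
  have same: "act (x i) s = act (x j) s" if "s \<in> S" for s using ij(2) that by (metis restrict_apply')
  have "\<forall>p\<in>P. act (inv (x i) \<otimes> x j) p = p"
  proof (rule S(3))
    show "inv (x i) \<otimes> x j \<in> C" using xC by simp
    show "\<forall>p\<in>S. act (inv (x i) \<otimes> x j) p = p"
    proof
      fix s assume s: "s \<in> S"
      then have "s \<in> P" using S(1) by blast
      then show "act (inv (x i) \<otimes> x j) s = s"
        using same[OF s] xG by (simp add: act_mult act_inv flip: same[OF s])
    qed
  qed
  then have xx: "act (x j) p = act (x i) p" if "p \<in> P" for p
    using that xG act_inv'[of "x i" "act (x j) p"] act_closed[of "x j" p] by (simp add: act_mult)
  have xact: "act (x l) (act (c [^] l) q) = act (c [^] l) (act k q)" if "q \<in> P" for l q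
  proof -
    have "x l \<otimes> c [^] l = c [^] l \<otimes> k" unfolding x_def using ci kG by (simp add: m_assoc)
    then show ?thesis using that ci kG xG by (metis act_mult)
  qed
  define r where "r = j - i"
  have "act (c [^] r) (act k q) = act k (act (c [^] r) q)" if q: "q \<in> P" for q
  proof -
    let ?q = "act (c [^] (r - i)) q"
    have kq: "act k q \<in> P" and kq': "act (c [^] r) q \<in> P" "act k (act (c [^] r) q) \<in> P"
      using q kG ci act_closed by auto
    have "act (c [^] i) (act (c [^] r) (act k q)) = act (c [^] j) (act k q)"
      using act_pow_add[OF c kq, of i r] unfolding r_def by simp
    also have "\<dots> = act (x j) (act (c [^] j) q)" using xact[OF q] by simp
    also have "\<dots> = act (x i) (act (c [^] j) q)" using xx q ci act_closed by simp
    also have "act (c [^] j) q = act (c [^] i) (act (c [^] r) q)"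
      using act_pow_add[OF c q, of i r] unfolding r_def by simp
    also have "act (x i) \<dots> = act (c [^] i) (act k (act (c [^] r) q))" using xact[OF kq'(1)] .
    finally show ?thesis using act_inj[OF ci _ kq'(2)] kq ci act_closed by blast
  qed
  moreover have "r \<noteq> 0" unfolding r_def using ij(1) by simp
  ultimately show ?thesis by blast
qed

lemma finite_normal_moved:
  assumes C: "C \<lhd> G" and fin: "\<And>p. p \<in> P \<Longrightarrow> finite ((\<lambda>a. act a p) ` C)"
    and k: "k \<in> C" and p: "p \<in> moved"
  shows "act k p \<in> moved"
proof -
  obtain r :: int where "r \<noteq> 0" "\<And>q. q \<in> P \<Longrightarrow> act (c [^] r) (act k q) = act k (act (c [^] r) q)"
    using eventually_commutes[OF C fin k] by blast
  moreover have "k \<in> carrier G" using k C by (meson normal_imp_subgroup subgroup.mem_carrier)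
  ultimately show ?thesis using commuting_moved p by blast
qed

text \<open>A power \<open>d\<close> of \<open>c\<close> commutes with \<open>k\<close> up to an element \<open>n\<close> that acts trivially and for which \<open>b\<close> is
flat. Flatness for \<open>k\<close>, which holds far out on the orbit of \<open>d\<close>, is therefore transported along it.\<close>

lemma finite_normal_flat:
  assumes C: "C \<lhd> G" and fin: "\<And>p. p \<in> P \<Longrightarrow> finite ((\<lambda>a. act a p) ` C)"
    and k: "k \<in> C" and p: "p \<in> moved"
  shows "flt k b p"
proof -
  obtain r :: int where r: "r \<noteq> 0"
    and comm: "\<And>q. q \<in> P \<Longrightarrow> act (c [^] r) (act k q) = act k (act (c [^] r) q)"
    using eventually_commutes[OF C fin k] by blast
  have kG: "k \<in> carrier G" using k C by (meson normal_imp_subgroup subgroup.mem_carrier)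
  have pP: "p \<in> P" using p by (rule movedD)
  define d where "d = c [^] r"
  have d: "d \<in> carrier G" unfolding d_def using c by simp
  define n where "n = k \<otimes> d \<otimes> inv (d \<otimes> k)"
  have n: "n \<in> carrier G" unfolding n_def using d kG by simp
  have nd: "n \<otimes> (d \<otimes> k) = k \<otimes> d" unfolding n_def using d kG by (simp add: m_assoc)
  have triv: "act n q = q" if q: "q \<in> P" for q
  proof -
    let ?q = "act (inv (d \<otimes> k)) q"
    have q': "?q \<in> P" using q d kG act_closed by simp
    have "act n q = act (k \<otimes> d) ?q" unfolding n_def using d kG q by (simp add: act_mult)
    also have "\<dots> = act (d \<otimes> k) ?q" using comm[OF q'] q' d kG by (simp add: act_mult d_def)
    also have "\<dots> = q" using act_inv'[of "d \<otimes> k" q] d kG q by simp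
    finally show ?thesis .
  qed
  have free: "free_at d p" unfolding d_def using moved_free[OF p] r by (rule free_at_pow)
  have dpow: "d [^] (i::int) = c [^] (r * i)" for i unfolding d_def using c by (simp add: int_pow_pow)
  have db: "flt d b q" if "q \<in> P" for q unfolding d_def using flat_int_pow[OF b c cb that] .
  let ?Q = "\<lambda>i::int. flt k b (act (d [^] i) p)"
  have "{i. \<not> ?Q i} \<subseteq> (\<lambda>i::int. act (d [^] i) p) -` {q \<in> P. \<not> flt k b q}"
    using d pP act_closed by auto
  moreover have "finite ((\<lambda>i::int. act (d [^] i) p) -` {q \<in> P. \<not> flt k b q})"
    using finite_defects[OF b kG] free_at_inj[OF d pP free] by (rule finite_vimageI)
  ultimately have finQ: "finite {i. \<not> ?Q i}" by (rule finite_subset)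
  have "?Q 0"
  proof (rule int_ascend[OF finQ])
    fix i :: int assume Qi: "?Q i"
    let ?q = "act (d [^] i) p"
    have qm: "?q \<in> moved" unfolding dpow using p by (rule pow_moved)
    have qP: "?q \<in> P" using qm by (rule movedD)
    have kq: "act k ?q \<in> P" using kG qP by (rule act_closed)
    have "act (d \<otimes> k) ?q = act d (act k ?q)" using d kG qP by (simp add: act_mult)
    moreover have "act d (act k ?q) \<in> moved"
    proof -
      have "act k ?q \<in> moved" using finite_normal_moved[OF C fin k qm] by blast
      from pow_moved[OF this, of r] show ?thesis by (simp only: d_def)
    qed
    ultimately have "flt n b (act (d \<otimes> k) ?q)" using flat_if_trivial[OF n triv] by simp
    moreover have "flt (d \<otimes> k) b ?q" using flat_mult[OF b d kG qP Qi] db kq by blast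
    ultimately have "flt (k \<otimes> d) b ?q" using flat_mult[OF b n _ qP] d kG nd by (metis m_closed)
    then have "flt k b (act d ?q)" using flat_mult_left[OF b kG d qP] db qP by blast
    then show "?Q (i + 1)" using act_pow_Suc[OF d pP, of i] by simp
  qed
  then show ?thesis using act_one[OF pP] by simp
qed

text \<open>The heart of the matter. Suppose that \<open>b\<close> is not flat for \<open>d\<close> at \<open>p\<close>, and let \<open>e'\<close> be the conjugate of
some \<open>e \<in> B\<close> by a high power of \<open>c\<close>. Since \<open>b\<close> is fixed by \<open>c\<close>, the defects of \<open>e'\<close> are translates of
those of \<open>e\<close> and have moved away from \<open>p\<close>, from \<open>act d p\<close> and from the finite \<open>C\<close>-orbit of \<open>p\<close>. Up to
\<open>C\<close> the elements \<open>d\<close> and \<open>e'\<close> commute. Going from \<open>p\<close> first by \<open>d\<close> and then by \<open>e'\<close> meets the defect of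
\<open>d\<close> at \<open>p\<close>; going first by \<open>e'\<close> and then by \<open>d\<close> meets none, unless \<open>e'\<close> sends \<open>p\<close> into the finite set
\<open>D\<close> of translates by \<open>C\<close> of the defects of \<open>d\<close>. So \<open>e'\<close> must do the latter. For a finite set
\<open>E \<subseteq> B\<close> and a common high power of \<open>c\<close>, this says that \<open>E\<close> sends a translate of \<open>p\<close> to at most
\<open>card D\<close> places, against \<open>uniformly_large_orbits\<close>.\<close>

lemma coherent_on_normal:
  assumes B: "B \<lhd> G" and inf: "\<And>p. p \<in> P \<Longrightarrow> infinite ((\<lambda>a. act a p) ` B)"
    and C: "C \<lhd> G" and fin: "\<And>p. p \<in> P \<Longrightarrow> finite ((\<lambda>a. act a p) ` C)"
    and BC: "\<And>x y. x \<in> B \<Longrightarrow> y \<in> B \<Longrightarrow> x \<otimes> y \<otimes> inv x \<otimes> inv y \<in> C"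
    and d: "d \<in> B" and p: "p \<in> moved" and dp: "act d p \<in> moved"
  shows "flt d b p"
proof (rule ccontr)
  assume nf: "\<not> flt d b p"
  interpret B: normal B G by (rule B)
  interpret C: normal C G by (rule C)
  have dG: "d \<in> carrier G" using d by simp
  have pP: "p \<in> P" using p by (rule movedD)
  define D where "D = (\<Union>q\<in>{q \<in> P. \<not> flt d b q}. (\<lambda>a. act a q) ` C)"
  have finD: "finite D" unfolding D_def using finite_defects[OF b dG] fin by blast
  define F where "F = insert (act d p) ((\<lambda>a. act a p) ` C)"
  have F: "finite F" "F \<subseteq> moved"
    unfolding F_def using fin[OF pP] dp finite_normal_moved[OF C fin _ p] by auto
  have key: "\<exists>m::nat. \<forall>i\<ge>int m. act (c [^] i \<otimes> e \<otimes> inv (c [^] i)) p \<in> D" if e: "e \<in> B" for e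
  proof -
    have eG: "e \<in> carrier G" using e by simp
    obtain m :: nat where
      m: "\<And>i q. \<bar>i\<bar> \<ge> int m \<Longrightarrow> q \<in> F \<Longrightarrow> act (c [^] i) q \<notin> {q \<in> P. \<not> flt e b q}"
      using free_at_escape[OF c F(1) _ _ finite_defects[OF b eG]] F(2) movedD(1) moved_free by blast
    show ?thesis
    proof (intro exI[of _ m] allI impI, rule ccontr)
      fix i :: int assume i: "int m \<le> i"
      define g where "g = c [^] i"
      define e' where "e' = g \<otimes> e \<otimes> inv g"
      assume "act (c [^] i \<otimes> e \<otimes> inv (c [^] i)) p \<notin> D"
      then have nD: "act e' p \<notin> D" unfolding e'_def g_def .
      have g: "g \<in> carrier G" unfolding g_def using c by simp
      have invg: "inv g = c [^] (- i)" unfolding g_def using c by (simp add: int_pow_neg)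
      have e'B: "e' \<in> B" unfolding e'_def using B.inv_op_closed2[OF g e] .
      have e'G: "e' \<in> carrier G" using e'B by simp
      have e'flat: "flt e' b q" if q: "q \<in> F" for q
      proof -
        have qP: "q \<in> P" using q F(2) movedD(1) by blast
        have q1: "act (inv g) q \<in> P" using act_closed g qP by simp
        have "flt e b (act (inv g) q)" using m[of "- i" q] i q q1 unfolding invg by auto
        moreover have "flt (inv g) b q" unfolding invg using flat_int_pow[OF b c cb qP] .
        ultimately have "flt (e \<otimes> inv g) b q" using flat_mult[OF b eG _ qP] g by simp
        moreover have "flt g b (act (e \<otimes> inv g) q)"
          unfolding g_def using flat_int_pow[OF b c cb] act_closed eG g qP by (simp add: g_def)
        ultimately have "flt (g \<otimes> (e \<otimes> inv g)) b q" using flat_mult[OF b g _ qP] eG g by simp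
        then show ?thesis unfolding e'_def using eG g by (simp add: m_assoc)
      qed
      \<comment> \<open>Chosen so that \<open>d \<otimes> e' \<otimes> k = e' \<otimes> d\<close>; the commutator is placed first, where \<open>b\<close> is known to be flat for \<open>C\<close>.\<close>
      define k where "k = inv e' \<otimes> inv d \<otimes> inv (inv e') \<otimes> inv (inv d)"
      have kC: "k \<in> C" unfolding k_def using BC[of "inv e'" "inv d"] e'B d by simp
      have kG: "k \<in> carrier G" using kC by simp
      have kp: "act k p \<in> F" unfolding F_def using kC by blast
      have kpP: "act k p \<in> P" using kG pP by (rule act_closed)
      have eq: "d \<otimes> (e' \<otimes> k) = e' \<otimes> d"
        unfolding k_def using e'G dG by (simp add: m_assoc cancel_inv_left)
      have "flt d b (act e' (act k p))"
      proof (rule ccontr)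
        assume n: "\<not> flt d b (act e' (act k p))"
        define k' where "k' = e' \<otimes> k \<otimes> inv e'"
        have k'C: "k' \<in> C" unfolding k'_def using C.inv_op_closed2[OF e'G kC] .
        have "k' \<otimes> e' = e' \<otimes> k" unfolding k'_def using e'G kG by (simp add: m_assoc)
        then have "act k' (act e' p) = act e' (act k p)"
          using k'C e'G kG pP by (metis C.mem_carrier act_mult)
        then have "act (inv k') (act e' (act k p)) = act e' p"
          using act_inv[of k' "act e' p"] k'C e'G pP act_closed by simp
        moreover have "inv k' \<in> C" using k'C by simp
        ultimately have "act e' p \<in> D"
          unfolding D_def using n act_closed[OF e'G kpP] by force
        then show False using nD by simp
      qed
      moreover have "flt k b p" using finite_normal_flat[OF C fin kC p] .
      ultimately have "flt (d \<otimes> (e' \<otimes> k)) b p"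
        using flat_mult[OF b dG, of "e' \<otimes> k" p] flat_mult[OF b e'G kG pP] e'flat[OF kp] e'G kG pP
        by (simp add: act_mult)
      then have "flt (e' \<otimes> d) b p" using eq by simp
      moreover have "flt e' b (act d p)" using e'flat unfolding F_def by simp
      ultimately have "flt d b p" using flat_mult_right[OF b e'G dG pP] by blast
      then show False using nf by simp
    qed
  qed
  obtain E where E: "E \<subseteq> B" "finite E" "\<And>q. q \<in> P \<Longrightarrow> card D < card ((\<lambda>a. act a q) ` E)"
    using uniformly_large_orbits[OF B.subgroup_axioms inf, of "card D"] by blast
  obtain m where m: "\<And>e i. e \<in> E \<Longrightarrow> int (m e) \<le> i \<Longrightarrow> act (c [^] i \<otimes> e \<otimes> inv (c [^] i)) p \<in> D"
    using key E(1) by (metis subsetD)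
  \<comment> \<open>A power of \<open>c\<close> that is high enough for all \<open>e \<in> E\<close>; the sum serves as an upper bound of the \<open>m e\<close>.\<close>
  define i where "i = int (\<Sum>e\<in>E. m e)"
  have i: "int (m e) \<le> i" if "e \<in> E" for e
    unfolding i_def using member_le_sum[OF that, of m] E(2) by (simp del: of_nat_sum)
  define g where "g = c [^] i"
  have g: "g \<in> carrier G" unfolding g_def using c by simp
  let ?q = "act (inv g) p"
  have qP: "?q \<in> P" using g pP act_closed by simp
  have "(\<lambda>a. act a ?q) ` E \<subseteq> act (inv g) ` D"
  proof
    fix z assume "z \<in> (\<lambda>a. act a ?q) ` E"
    then obtain e where e: "e \<in> E" "z = act e ?q" by blast
    have eG: "e \<in> carrier G" using e(1) E(1) by auto
    have "act (g \<otimes> e \<otimes> inv g) p = act g (act e ?q)" using eG g pP qP by (simp add: act_mult)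
    then have "act g z \<in> D" using m[OF e(1) i[OF e(1)]] e(2) unfolding g_def by simp
    moreover have "z = act (inv g) (act g z)" using e(2) act_inv[OF g] act_closed[OF eG qP] by simp
    ultimately show "z \<in> act (inv g) ` D" by blast
  qed
  then have "card ((\<lambda>a. act a ?q) ` E) \<le> card (act (inv g) ` D)" using finD by (intro card_mono) auto
  also have "\<dots> \<le> card D" using finD by (rule card_image_le)
  finally show False using E(3)[OF qP] by simp
qed

text \<open>The complement of \<open>act a ` moved\<close> is the fixed point set of \<open>a \<otimes> c \<otimes> inv a\<close>, so a finite cover is
the chain condition applied to the conjugates of \<open>c\<close>.\<close>

lemma finite_cover_by_translates:
  assumes K: "subgroup K G"
  shows "\<exists>T\<subseteq>K. finite T \<and> (\<forall>a\<in>K. \<forall>p\<in>moved. \<exists>t\<in>T. \<exists>q\<in>moved. act a p = act t q)"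
proof -
  have KG: "K \<subseteq> carrier G" using K by (rule subgroup.subset)
  let ?f = "\<lambda>a. a \<otimes> c \<otimes> inv a"
  have f: "act (?f a) (act a p) = act a (act c p)" if "a \<in> K" "p \<in> P" for a p
    using that KG c act_closed by (simp add: act_mult act_inv subset_iff)
  have "?f ` K \<subseteq> carrier G" using KG c by auto
  from finite_fixpoint_basis[OF this] obtain T0 where
    T0: "T0 \<subseteq> ?f ` K" "finite T0" "Fixp T0 = Fixp (?f ` K)" by blast
  obtain T where T: "T \<subseteq> K" "finite T" "T0 = ?f ` T" using finite_subset_image[OF T0(2,1)] by blast
  have "\<exists>t\<in>T. \<exists>q\<in>moved. act a p = act t q" if a: "a \<in> K" and p: "p \<in> moved" for a p
  proof -
    have aG: "a \<in> carrier G" and pP: "p \<in> P" using a KG movedD(1)[OF p] by auto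
    have "act (?f a) (act a p) \<noteq> act a p"
      using f[OF a pP] act_inj[OF aG act_closed[OF c pP] pP] movedD(2)[OF p] by auto
    then have "act a p \<notin> Fixp (?f ` K)" using a unfolding common_fixpoints_def by blast
    then have "act a p \<notin> Fixp (?f ` T)" using T0(3) T(3) by simp
    then obtain t where t: "t \<in> T" "act (?f t) (act a p) \<noteq> act a p"
      using act_closed[OF aG pP] unfolding common_fixpoints_def by blast
    have tG: "t \<in> carrier G" using t(1) T(1) KG by blast
    let ?q = "act (inv t) (act a p)"
    have qP: "?q \<in> P" using act_closed tG aG pP by simp
    have tq: "act t ?q = act a p" using act_inv'[OF tG act_closed[OF aG pP]] .
    have "act c ?q \<noteq> ?q" using f[of t ?q] t T(1) qP tq by auto
    then have "?q \<in> moved" using qP by (simp add: moved_def)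
    then show ?thesis using t(1) tq by metis
  qed
  then show ?thesis using T(1,2) by blast
qed

text \<open>First \<open>b\<close> is spread over the \<open>B\<close>-translates of \<open>moved\<close>. The result \<open>b'\<close> is flat for \<open>B\<close> there, so on
each orbit of \<open>B\<close> one of its values determines all others. Since \<open>B\<close> is normal, any \<open>h\<close> permutes these
orbits and carries \<open>b'\<close> to a section with the same property. As \<open>b'\<close> is flat for \<open>h\<close> almost everywhere
and the orbits of \<open>B\<close> are infinite, it is flat for \<open>h\<close> at some point of each of them, hence wherever
\<open>h\<close> maps \<open>moved\<close> to itself. So \<open>b\<close> is flat for all group elements between points of \<open>moved\<close>, and it can
be spread a second time, over everything.\<close>

theorem invariant_section:
  assumes B: "B \<lhd> G" and inf: "\<And>p. p \<in> P \<Longrightarrow> infinite ((\<lambda>a. act a p) ` B)"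
    and C: "C \<lhd> G" and fin: "\<And>p. p \<in> P \<Longrightarrow> finite ((\<lambda>a. act a p) ` C)"
    and BC: "\<And>x y. x \<in> B \<Longrightarrow> y \<in> B \<Longrightarrow> x \<otimes> y \<otimes> inv x \<otimes> inv y \<in> C"
    and ne: "moved \<noteq> {}"
  shows "\<exists>y. sect y \<and> (\<forall>a\<in>carrier G. \<forall>p\<in>P. flt a y p)"
proof -
  interpret B: normal B G by (rule B)
  have mP: "moved \<subseteq> P" by (auto simp: moved_def)
  obtain T where T: "T \<subseteq> B" "finite T" "\<forall>a\<in>B. \<forall>p\<in>moved. \<exists>t\<in>T. \<exists>q\<in>moved. act a p = act t q"
    using finite_cover_by_translates[OF B.subgroup_axioms] by blast
  have "\<exists>b'. sect b' \<and> (\<forall>a\<in>B. \<forall>p\<in>moved. b' (act a p) = tr a p (b p))"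
    using glue[OF B.subgroup_axioms mP b coherent_on_normal[OF B inf C fin BC] T(2,1)] T(3) by blast
  then obtain b' where b': "sect b'" "\<forall>a\<in>B. \<forall>p\<in>moved. b' (act a p) = tr a p (b p)" by blast
  have coh: "flt h b p" if h: "h \<in> carrier G" and p: "p \<in> moved" and hp: "act h p \<in> moved" for h p
  proof -
    have pP: "p \<in> P" and hpP: "act h p \<in> P" using movedD(1) p hp by auto
    have "infinite ((\<lambda>a. act a p) ` B - {q \<in> P. \<not> flt h b' q})"
      using inf[OF pP] finite_defects[OF b'(1) h] by (rule Diff_infinite_finite[rotated])
    then obtain z where "z \<in> (\<lambda>a. act a p) ` B - {q \<in> P. \<not> flt h b' q}"
      using infinite_imp_nonempty by blast
    then obtain a where a: "a \<in> B" "act a p \<notin> {q \<in> P. \<not> flt h b' q}" by blast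
    have aG: "a \<in> carrier G" using a(1) by simp
    have fl: "flt h b' (act a p)" using a(2) act_closed[OF aG pP] by simp
    define a' where "a' = h \<otimes> a \<otimes> inv h"
    have a'B: "a' \<in> B" unfolding a'_def using B.inv_op_closed2[OF h a(1)] .
    have a'G: "a' \<in> carrier G" using a'B by simp
    have eq: "a' \<otimes> h = h \<otimes> a" unfolding a'_def using h aG by (simp add: m_assoc)
    have bX: "b p \<in> X0" "b (act h p) \<in> X0" "tr h p (b p) \<in> X0"
      using sect_in[OF b] pP hpP tr_closed h by auto
    have "tr a' (act h p) (tr h p (b p)) = tr h (act a p) (tr a p (b p))"
      using tr_mult[OF a'G h pP bX(1)] tr_mult[OF h aG pP bX(1)] eq by simp
    also have "\<dots> = b' (act h (act a p))" using fl b'(2) a(1) p by (simp add: flat_def)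
    also have "act h (act a p) = act a' (act h p)"
      using act_mult[OF a'G h pP] act_mult[OF h aG pP] eq by simp
    also have "b' \<dots> = tr a' (act h p) (b (act h p))" using b'(2) a'B hp by blast
    finally show ?thesis using tr_inj[OF a'G hpP bX(3,2)] by (simp add: flat_def)
  qed
  obtain T' where T': "T' \<subseteq> carrier G" "finite T'"
    "\<forall>a\<in>carrier G. \<forall>p\<in>moved. \<exists>t\<in>T'. \<exists>q\<in>moved. act a p = act t q"
    using finite_cover_by_translates[OF subgroup_self] by blast
  have "\<exists>y. sect y \<and> (\<forall>a\<in>carrier G. \<forall>p\<in>moved. y (act a p) = tr a p (b p))"
    using glue[OF subgroup_self mP b coh T'(2,1)] T'(3) by blast
  then obtain y where y: "sect y" "\<forall>a\<in>carrier G. \<forall>p\<in>moved. y (act a p) = tr a p (b p)" by blast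
  obtain p0 where p0: "p0 \<in> moved" using ne by blast
  have "flt a y p" if a: "a \<in> carrier G" and p: "p \<in> P" for a p
  proof -
    obtain g where g: "g \<in> carrier G" "act g p0 = p" using trans[OF movedD(1)[OF p0] p] by blast
    then show ?thesis using glued_flat[OF subgroup_self mP b y(2) a g(1) p0] by simp
  qed
  then show ?thesis using y(1) by blast
qed

end

section \<open>Infinite orbits\<close>

context elliptic_bundle
begin

text \<open>Otherwise every element has a power that acts trivially, and the group of permutations of \<open>P\<close>
induced by \<open>G\<close> is a finitely generated torsion group, virtually solvable, hence finite; its orbit
\<open>P\<close> would be finite.\<close>

lemma exists_free:
  assumes fg: "finitely_generated G" and inf: "infinite P"
    and L: "subgroup L G" "finite_index G L"
    and triv: "\<And>a p. a \<in> (derived G ^^ n) L \<Longrightarrow> p \<in> P \<Longrightarrow> act a p = p"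
  shows "\<exists>c\<in>carrier G. \<exists>p\<in>P. free_at c p"
proof (rule ccontr)
  assume nf: "\<not> (\<exists>c\<in>carrier G. \<exists>p\<in>P. free_at c p)"
  define N where "N = {a \<in> carrier G. \<forall>p\<in>P. act a p = p}"
  have sub: "subgroup N G"
  proof (rule subgroupI)
    show "N \<noteq> {}" unfolding N_def using act_one by blast
    show "inv a \<in> N" if "a \<in> N" for a
      using that act_inv[of a] unfolding N_def by auto
    show "a \<otimes> a' \<in> N" if "a \<in> N" "a' \<in> N" for a a'
      using that unfolding N_def by (auto simp: act_mult)
  qed (auto simp: N_def)
  have N: "N \<lhd> G"
  proof (rule normal_invI[OF sub])
    fix x h assume x: "x \<in> carrier G" and h: "h \<in> N"
    have "act (x \<otimes> h \<otimes> inv x) p = p" if "p \<in> P" for p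
      using that x h act_closed[of "inv x" p] unfolding N_def by (simp add: act_mult act_inv')
    then show "x \<otimes> h \<otimes> inv x \<in> N" using x h unfolding N_def by simp
  qed
  interpret N: normal N G by (rule N)
  let ?Q = "G Mod N"
  interpret Q: group ?Q by (rule N.factorgroup_is_group)
  interpret h: group_hom G ?Q "\<lambda>a. N #> a"
    using N.r_coset_hom_Mod by unfold_locales
  have surj: "(\<lambda>a. N #> a) ` carrier G = carrier ?Q" by (simp add: carrier_FactGroup)
  have N_one: "N #> a = \<one>\<^bsub>?Q\<^esub>" if "a \<in> N" for a
    using that N.rcos_const by simp
  have "finite (carrier ?Q)"
  proof (rule Q.finite_if_torsion_virtually_solvable)
    obtain S where S: "finite S" "S \<subseteq> carrier G" "generate G S = carrier G"
      using fg unfolding finitely_generated_def by blast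
    then have "generate ?Q ((\<lambda>a. N #> a) ` S) = carrier ?Q" using h.generate_img[OF S(2)] surj by simp
    then show "finitely_generated ?Q"
      unfolding finitely_generated_def using S surj by (intro exI[of _ "(\<lambda>a. N #> a) ` S"]) auto
  next
    fix z assume "z \<in> carrier ?Q"
    then obtain a where a: "a \<in> carrier G" "z = N #> a" using surj by blast
    obtain M :: nat where M: "M > 0" "\<forall>p\<in>P. act (a [^] M) p = p \<or> free_at (a [^] M) p"
      using power_fixed_or_free[OF a(1)] by blast
    then have "a [^] M \<in> N" using nf a(1) unfolding N_def by simp
    then have "z [^]\<^bsub>?Q\<^esub> M = \<one>\<^bsub>?Q\<^esub>" using h.hom_nat_pow[OF a(1), of M] a(2) N_one by simp
    then show "\<exists>n>0. z [^]\<^bsub>?Q\<^esub> (n::nat) = \<one>\<^bsub>?Q\<^esub>" using M(1) by blast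
  next
    show "subgroup ((\<lambda>a. N #> a) ` L) ?Q" by (rule h.subgroup_img_is_subgroup[OF L(1)])
    obtain T where T: "T \<subseteq> carrier G" "finite T" "\<And>a. a \<in> carrier G \<Longrightarrow> \<exists>t\<in>T. a \<otimes> inv t \<in> L"
      using L(2) unfolding finite_index_def by metis
    show "finite_index ?Q ((\<lambda>a. N #> a) ` L)"
      unfolding finite_index_def
    proof (intro exI[of _ "(\<lambda>a. N #> a) ` T"] conjI ballI)
      show "(\<lambda>a. N #> a) ` T \<subseteq> carrier ?Q" using T(1) h.hom_closed by blast
      show "finite ((\<lambda>a. N #> a) ` T)" using T(2) by blast
      fix z assume "z \<in> carrier ?Q"
      then obtain a where a: "a \<in> carrier G" "z = N #> a" using surj by blast
      obtain t where t: "t \<in> T" "a \<otimes> inv t \<in> L" using T(3)[OF a(1)] by blast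
      have tG: "t \<in> carrier G" using t(1) T(1) by blast
      have "z \<otimes>\<^bsub>?Q\<^esub> inv\<^bsub>?Q\<^esub> (N #> t) = N #> (a \<otimes> inv t)"
        using h.hom_mult[OF a(1) inv_closed[OF tG]] h.hom_inv[OF tG] a(2) by simp
      then show "\<exists>t\<in>(\<lambda>a. N #> a) ` T. z \<otimes>\<^bsub>?Q\<^esub> inv\<^bsub>?Q\<^esub> t \<in> (\<lambda>a. N #> a) ` L"
        using t by (metis (no_types, lifting) imageI)
    qed
    have D: "(derived G ^^ n) L \<subseteq> N" and D1: "\<one> \<in> (derived G ^^ n) L"
      using triv exp_of_derived_in_carrier[OF subgroup.subset[OF L(1)], of n]
        subgroup.one_closed[OF exp_of_derived_is_subgroup[OF L(1)]] unfolding N_def by auto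
    have "(derived ?Q ^^ n) ((\<lambda>a. N #> a) ` L) = (\<lambda>a. N #> a) ` ((derived G ^^ n) L)"
      by (rule h.exp_of_derived_img[OF subgroup.subset[OF L(1)]])
    also have "\<dots> = {\<one>\<^bsub>?Q\<^esub>}" using D D1 N_one by blast
    finally show "(derived ?Q ^^ n) ((\<lambda>a. N #> a) ` L) = {\<one>\<^bsub>?Q\<^esub>}" .
  qed
  moreover obtain p where p: "p \<in> P" using inf infinite_imp_nonempty by blast
  have "P \<subseteq> (\<lambda>Z. act (SOME a. a \<in> carrier G \<and> N #> a = Z) p) ` carrier ?Q"
  proof
    fix q assume q: "q \<in> P"
    obtain a where a: "a \<in> carrier G" "act a p = q" using trans[OF p q] by blast
    define a' where "a' = (SOME a'. a' \<in> carrier G \<and> N #> a' = N #> a)"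
    have a': "a' \<in> carrier G" "N #> a' = N #> a"
      using someI[of "\<lambda>a'. a' \<in> carrier G \<and> N #> a' = N #> a" a] a(1) unfolding a'_def by auto
    have "a \<in> N #> a'" using a' a(1) sub rcos_self by metis
    then obtain k where "k \<in> N" "a = k \<otimes> a'" unfolding r_coset_def by blast
    then have "act a' p = q" using a(2) a'(1) p act_closed unfolding N_def by (simp add: act_mult)
    then show "q \<in> (\<lambda>Z. act (SOME a. a \<in> carrier G \<and> N #> a = Z) p) ` carrier ?Q"
      using surj a(1) unfolding a'_def by blast
  qed
  ultimately show False using inf finite_surj by blast
qed

lemma normal_orbits_finite:
  assumes K: "K \<lhd> G" and p: "p \<in> P" and q: "q \<in> P" and fin: "finite ((\<lambda>a. act a p) ` K)"
  shows "finite ((\<lambda>a. act a q) ` K)"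
proof -
  interpret K: normal K G by (rule K)
  obtain g where g: "g \<in> carrier G" "act g p = q" using trans[OF p q] by blast
  have "(\<lambda>a. act a q) ` K \<subseteq> act g ` (\<lambda>a. act a p) ` K"
  proof
    fix z assume "z \<in> (\<lambda>a. act a q) ` K"
    then obtain a where a: "a \<in> K" "z = act a q" by blast
    have "inv g \<otimes> a \<otimes> g \<in> K" using K.inv_op_closed1[OF g(1) a(1)] .
    moreover have "act g (act (inv g \<otimes> a \<otimes> g) p) = z"
      using g a(2) K.mem_carrier[OF a(1)] p q act_closed by (simp add: act_mult act_inv')
    ultimately show "z \<in> act g ` (\<lambda>a. act a p) ` K" by (metis imageI)
  qed
  then show ?thesis using fin finite_subset by blast
qed

text \<open>The orbits of \<open>L\<close> are infinite because \<open>L\<close> has finite index, while the \<open>n\<close>-th term of its derived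
series acts trivially. Let \<open>B\<close> be the last term with infinite orbits and \<open>C\<close> the next one.\<close>

theorem infinite_orbit_fixed_section:
  assumes fg: "finitely_generated G" and inf: "infinite P"
    and L: "L \<lhd> G" "finite_index G L"
    and triv: "\<And>a p. a \<in> (derived G ^^ n) L \<Longrightarrow> p \<in> P \<Longrightarrow> act a p = p"
  shows "\<exists>y. sect y \<and> (\<forall>a\<in>carrier G. \<forall>p\<in>P. flt a y p)"
proof -
  let ?S = "\<lambda>i. (derived G ^^ i) L"
  have Lsub: "subgroup L G" using L(1) by (rule normal_imp_subgroup)
  have S: "?S i \<lhd> G" for i using L(1) derived_is_normal by (induct i) auto
  obtain c0 p0 where c0: "c0 \<in> carrier G" "p0 \<in> P" "free_at c0 p0"
    using exists_free[OF fg inf Lsub L(2) triv] by blast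
  let ?inf = "\<lambda>i. infinite ((\<lambda>a. act a p0) ` ?S i)"
  have inf0: "?inf 0"
  proof
    assume "finite ((\<lambda>a. act a p0) ` ?S 0)"
    then have fin: "finite ((\<lambda>a. act a q) ` L)" if "q \<in> P" for q
      using normal_orbits_finite[OF L(1) c0(2) that] by simp
    obtain T where T: "T \<subseteq> carrier G" "finite T" "\<And>a. a \<in> carrier G \<Longrightarrow> \<exists>t\<in>T. a \<otimes> inv t \<in> L"
      using L(2) unfolding finite_index_def by metis
    have "P \<subseteq> (\<Union>t\<in>T. (\<lambda>a. act a (act t p0)) ` L)"
    proof
      fix q assume "q \<in> P"
      then obtain a where a: "a \<in> carrier G" "act a p0 = q" using trans[OF c0(2)] by blast
      obtain t where t: "t \<in> T" "a \<otimes> inv t \<in> L" using T(3)[OF a(1)] by blast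
      have "act (a \<otimes> inv t) (act t p0) = q"
        using a t(1) T(1) c0(2) act_closed by (simp add: act_mult act_inv subset_iff)
      then show "q \<in> (\<Union>t\<in>T. (\<lambda>a. act a (act t p0)) ` L)" using t by blast
    qed
    moreover have "finite (\<Union>t\<in>T. (\<lambda>a. act a (act t p0)) ` L)"
      using T(1,2) fin act_closed c0(2) by blast
    ultimately show False using inf finite_subset by blast
  qed
  have "(\<lambda>a. act a p0) ` ?S n \<subseteq> {p0}" using triv c0(2) by blast
  then have "\<not> ?inf n" using finite_subset by blast
  then have "\<exists>i. ?inf i \<and> \<not> ?inf (Suc i)" using inf0 by (induct n) auto
  then obtain i where i: "?inf i" "finite ((\<lambda>a. act a p0) ` ?S (Suc i))" by blast
  obtain M :: nat where M: "M > 0" "\<forall>p\<in>P. act (c0 [^] M) p = p \<or> free_at (c0 [^] M) p"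
    using power_fixed_or_free[OF c0(1)] by blast
  define c where "c = c0 [^] M"
  have cG: "c \<in> carrier G" unfolding c_def using c0(1) by simp
  obtain b where b: "sect b" "\<forall>p\<in>P. flt c b p" using elliptic[OF cG] by blast
  interpret periodic_section G P act X0 tr x0 c b
    by unfold_locales (use cG b M(2) c_def in auto)
  have "act c p0 \<noteq> p0"
    using c0(3) M(1) int_pow_int[of G c0 M] unfolding free_at_def c_def by (metis of_nat_0_less_iff less_irrefl)
  then have "moved \<noteq> {}" using c0(2) by (auto simp: moved_def)
  then show ?thesis
  proof (rule invariant_section[rotated -1])
    show "?S i \<lhd> G" "?S (Suc i) \<lhd> G" by (rule S)+
    show "infinite ((\<lambda>a. act a p) ` ?S i)" if "p \<in> P" for p
      using normal_orbits_finite[OF S that c0(2)] i(1) by blast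
    show "finite ((\<lambda>a. act a p) ` ?S (Suc i))" if "p \<in> P" for p
      using normal_orbits_finite[OF S c0(2) that] i(2) by blast
    show "x \<otimes> y \<otimes> inv x \<otimes> inv y \<in> ?S (Suc i)" if "x \<in> ?S i" "y \<in> ?S i" for x y
    proof -
      have "x \<otimes> y \<otimes> inv x \<otimes> inv y \<in> derived_set G (?S i)" using that by blast
      then show ?thesis by (simp add: derived_def generate.incl)
    qed
  qed
qed

end

section \<open>Assembling the orbits\<close>

context bundle_action
begin

lemma flat_if_generators_flat:
  assumes "sect y" "S \<subseteq> carrier G" "\<And>s p. s \<in> S \<Longrightarrow> p \<in> P \<Longrightarrow> flt s y p"
    and "a \<in> generate G S" "p \<in> P"
  shows "flt a y p"
proof -
  have "S \<subseteq> {a \<in> carrier G. \<forall>p\<in>P. flt a y p}" using assms(2,3) by blast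
  from generate_subgroup_incl[OF this flat_subgroup[OF assms(1)]] show ?thesis using assms(4,5) by blast
qed

lemma restrict_to_invariant:
  assumes "Q \<subseteq> P" "\<And>a p. a \<in> carrier G \<Longrightarrow> p \<in> Q \<Longrightarrow> act a p \<in> Q"
  shows "bundle_action G Q act X0 tr x0"
proof unfold_locales
  show "finite {p \<in> Q. tr a p x0 \<noteq> x0}" if "a \<in> carrier G" for a
    by (rule finite_subset[OF _ almost_flat[OF that]]) (use assms(1) in auto)
qed (use assms act_one act_mult tr_closed tr_one tr_mult x0 in \<open>auto simp: subset_iff\<close>)

text \<open>The constant section \<open>x0\<close> is flat for the finitely many generators, hence for the whole group, on
every orbit that avoids the finite set \<open>Bad\<close>. Only finitely many orbits remain, so fixed
sections on them can be inserted without leaving the restricted product.\<close>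

theorem fixed_section:
  assumes fg: "finitely_generated G"
    and ell: "\<And>a. a \<in> carrier G \<Longrightarrow> \<exists>y. sect y \<and> (\<forall>p\<in>P. flt a y p)"
    and chains: "\<And>Q. Q \<subseteq> P \<Longrightarrow> bounded_fixpoint_chains Q act (carrier G)"
    and decent: "\<And>p Y. p \<in> P \<Longrightarrow> finite Y \<Longrightarrow> generate G Y \<subseteq> {a \<in> carrier G. act a p = p} \<Longrightarrow>
        Y \<subseteq> carrier G \<Longrightarrow>
        (\<And>a. a \<in> generate G Y \<Longrightarrow> \<exists>x\<in>X0. tr a p x = x) \<Longrightarrow> \<exists>x\<in>X0. \<forall>a\<in>generate G Y. tr a p x = x"
    and L: "L \<lhd> G" "finite_index G L"
    and triv: "\<And>a p. a \<in> (derived G ^^ n) L \<Longrightarrow> p \<in> P \<Longrightarrow> act a p = p"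
  shows "\<exists>y. sect y \<and> (\<forall>a\<in>carrier G. \<forall>p\<in>P. flt a y p)"
proof -
  define Orb where "Orb p = (\<lambda>a. act a p) ` carrier G" for p
  have self: "p \<in> Orb p" if "p \<in> P" for p
    unfolding Orb_def using act_one[OF that] by (metis image_iff one_closed)
  have sub: "Orb p \<subseteq> P" if "p \<in> P" for p unfolding Orb_def using that act_closed by blast
  have eq: "Orb (act a p) = Orb p" if a: "a \<in> carrier G" and p: "p \<in> P" for a p
  proof
    show "Orb (act a p) \<subseteq> Orb p"
    proof
      fix q assume "q \<in> Orb (act a p)"
      then obtain g where "g \<in> carrier G" "q = act g (act a p)" unfolding Orb_def by blast
      then show "q \<in> Orb p" unfolding Orb_def
        using act_mult[of g a p] a p by (intro image_eqI[of _ _ "g \<otimes> a"]) auto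
    qed
    show "Orb p \<subseteq> Orb (act a p)"
    proof
      fix q assume "q \<in> Orb p"
      then obtain g where g: "g \<in> carrier G" "q = act g p" unfolding Orb_def by blast
      then have "q = act (g \<otimes> inv a) (act a p)" using a p act_closed by (simp add: act_mult act_inv)
      then show "q \<in> Orb (act a p)" unfolding Orb_def using g a by blast
    qed
  qed
  have orb_section: "\<exists>y. finite_section (Orb p) X0 x0 y \<and> (\<forall>a\<in>carrier G. \<forall>q\<in>Orb p. flt a y q)"
    if p: "p \<in> P" for p
  proof -
    interpret O: bundle_action G "Orb p" act X0 tr x0
    proof (rule restrict_to_invariant[OF sub[OF p]])
      show "act a q \<in> Orb p" if a: "a \<in> carrier G" and q: "q \<in> Orb p" for a q
      proof -
        obtain g where "g \<in> carrier G" "q = act g p" using q unfolding Orb_def by blast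
        then show ?thesis unfolding Orb_def
          using act_mult[of a g p] a p by (intro image_eqI[of _ _ "a \<otimes> g"]) auto
      qed
    qed
    have trans: "\<exists>a\<in>carrier G. act a q = r" if q: "q \<in> Orb p" and r: "r \<in> Orb p" for q r
    proof -
      obtain g where "g \<in> carrier G" "q = act g p" using q unfolding Orb_def by blast
      then have "r \<in> Orb q" using r eq p by simp
      then show ?thesis unfolding Orb_def by blast
    qed
    have ellO: "\<exists>y. finite_section (Orb p) X0 x0 y \<and> (\<forall>q\<in>Orb p. flt a y q)" if a: "a \<in> carrier G" for a
    proof -
      obtain y where y: "sect y" "\<forall>p\<in>P. flt a y p" using ell[OF a] by blast
      have "finite {q \<in> Orb p. y q \<noteq> x0}"
        using y(1) sub[OF p] by (auto simp: finite_section_def intro: rev_finite_subset)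
      then show ?thesis using y sub[OF p] by (auto simp: finite_section_def)
    qed
    show ?thesis
    proof (cases "finite (Orb p)")
      case True
      then show ?thesis
      proof (rule O.finite_orbit_fixed_section[OF fg _ trans ellO])
        fix q Y assume "q \<in> Orb p" "finite Y" "generate G Y \<subseteq> {a \<in> carrier G. act a q = q}"
          "Y \<subseteq> carrier G" "\<And>a. a \<in> generate G Y \<Longrightarrow> \<exists>x\<in>X0. tr a q x = x"
        then show "\<exists>x\<in>X0. \<forall>a\<in>generate G Y. tr a q x = x" using decent[of q Y] sub[OF p] by blast
      qed
    next
      case False
      interpret O: elliptic_bundle G "Orb p" act X0 tr x0
        by unfold_locales (use trans ellO chains[OF sub[OF p]] in auto)
      show ?thesis
        by (rule O.infinite_orbit_fixed_section[OF fg False L]) (use triv sub[OF p] in blast)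
    qed
  qed
  obtain S where S: "finite S" "S \<subseteq> carrier G" "generate G S = carrier G"
    using fg unfolding finitely_generated_def by blast
  define Bad where "Bad = (\<Union>s\<in>S. {p \<in> P. tr s p x0 \<noteq> x0})"
  have finBad: "finite Bad" unfolding Bad_def using S(1,2) almost_flat by blast
  have BadP: "Bad \<subseteq> P" unfolding Bad_def by blast
  have "\<exists>Y. \<forall>Q\<in>Orb ` P. finite_section Q X0 x0 (Y Q) \<and> (\<forall>a\<in>carrier G. \<forall>q\<in>Q. flt a (Y Q) q)"
    using orb_section by (intro bchoice) blast
  then obtain Y where Y: "\<And>p. p \<in> P \<Longrightarrow> finite_section (Orb p) X0 x0 (Y (Orb p))"
    "\<And>p a q. p \<in> P \<Longrightarrow> a \<in> carrier G \<Longrightarrow> q \<in> Orb p \<Longrightarrow> flt a (Y (Orb p)) q" by blast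
  define y where "y p = (if Orb p \<inter> Bad = {} then x0 else Y (Orb p) p)" for p
  have "{p \<in> P. y p \<noteq> x0} \<subseteq> (\<Union>q\<in>Bad. {p \<in> Orb q. Y (Orb q) p \<noteq> x0})"
  proof
    fix p assume p: "p \<in> {p \<in> P. y p \<noteq> x0}"
    then obtain q where q: "q \<in> Orb p" "q \<in> Bad" unfolding y_def by (auto split: if_splits)
    obtain g where "g \<in> carrier G" "q = act g p" using q(1) unfolding Orb_def by blast
    then have oq: "Orb q = Orb p" using eq p by simp
    have "p \<in> {p \<in> Orb q. Y (Orb q) p \<noteq> x0}"
      unfolding oq using p self unfolding y_def by (auto split: if_splits)
    then show "p \<in> (\<Union>q\<in>Bad. {p \<in> Orb q. Y (Orb q) p \<noteq> x0})" using q(2) by blast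
  qed
  moreover have "finite (\<Union>q\<in>Bad. {p \<in> Orb q. Y (Orb q) p \<noteq> x0})"
    using finBad BadP Y(1) by (auto simp: finite_section_def)
  ultimately have "finite {p \<in> P. y p \<noteq> x0}" by (rule finite_subset)
  moreover have "y p \<in> X0" if "p \<in> P" for p
    using Y(1)[OF that] self[OF that] x0 unfolding y_def finite_section_def by auto
  ultimately have sy: "sect y" unfolding finite_section_def by blast
  have "flt s y p" if s: "s \<in> S" and p: "p \<in> P" for s p
  proof -
    have sG: "s \<in> carrier G" using s S(2) by blast
    show ?thesis
    proof (cases "Orb p \<inter> Bad = {}")
      case True
      then have "tr s p x0 = x0" using self[OF p] s p unfolding Bad_def by blast
      then show ?thesis using True eq[OF sG p] by (simp add: flat_def y_def)
    next
      case False
      then show ?thesis using Y(2)[OF p sG self[OF p]] eq[OF sG p] by (simp add: flat_def y_def)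
    qed
  qed
  then have "flt a y p" if "a \<in> carrier G" "p \<in> P" for a p
    using flat_if_generators_flat[OF sy S(2)] S(3) that by blast
  then show ?thesis using sy by blast
qed

end

section \<open>The projective linear group\<close>

lemma mat_mult_vec: "mat c *v (v :: 'k::field ^ 'n) = c *s v"
proof (subst vec_eq_iff, intro allI)
  fix i
  have "(mat c *v v) $ i = (\<Sum>j\<in>UNIV. if j = i then c * v $ j else 0)"
    unfolding matrix_vector_mult_def mat_def by (simp add: if_distrib[of "\<lambda>x. x * _"] eq_commute cong: if_cong)
  then show "(mat c *v v) $ i = (c *s v) $ i" by simp
qed

lemma mat_mult_mat: "mat a ** mat b = (mat (a * b) :: 'k::field ^ 'n ^ 'n)"
  by (simp add: matrix_eq mat_mult_vec matrix_vector_mul_assoc[symmetric] vector_smult_assoc)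

lemma mat_commute: "(A :: 'k::field ^ 'n ^ 'n) ** mat c = mat c ** A"
  by (simp add: matrix_eq mat_mult_vec matrix_vector_mul_assoc[symmetric] vec.scale)

lemma invertible_mat: "c \<noteq> 0 \<Longrightarrow> invertible (mat c :: 'k::field ^ 'n ^ 'n)"
  unfolding invertible_def by (intro exI[of _ "mat (inverse c)"]) (simp add: mat_mult_mat)

lemma group_GL: "group (GL :: ('k::field ^ 'n ^ 'n) monoid)"
proof (rule groupI)
  fix A :: "'k ^ 'n ^ 'n" assume "A \<in> carrier GL"
  then obtain B where B: "A ** B = mat 1" "B ** A = mat 1" unfolding GL_def invertible_def by auto
  then have "invertible B" unfolding invertible_def by blast
  then show "\<exists>B\<in>carrier GL. B \<otimes>\<^bsub>GL\<^esub> A = \<one>\<^bsub>GL\<^esub>" using B unfolding GL_def by auto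
qed (auto simp: GL_def invertible_mult invertible_mat matrix_mul_assoc)

abbreviation scalars :: "('k::field ^ 'n ^ 'n) set" where
  "scalars \<equiv> {mat c | c. c \<noteq> 0}"

lemma normal_scalars: "(scalars :: ('k::field ^ 'n ^ 'n) set) \<lhd> GL"
proof -
  interpret GL: group "GL :: ('k ^ 'n ^ 'n) monoid" by (rule group_GL)
  have inv: "inv\<^bsub>GL\<^esub> (mat c) = (mat (inverse c) :: 'k ^ 'n ^ 'n)" if "c \<noteq> 0" for c
    using that by (intro GL.inv_equality) (auto simp: GL_def mat_mult_mat invertible_mat)
  have "subgroup (scalars :: ('k ^ 'n ^ 'n) set) GL"
  proof (rule GL.subgroupI)
    show "(scalars :: ('k ^ 'n ^ 'n) set) \<subseteq> carrier GL" by (auto simp: GL_def invertible_mat)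
    have "mat 1 \<in> (scalars :: ('k ^ 'n ^ 'n) set)" by (auto intro: exI[of _ 1])
    then show "(scalars :: ('k ^ 'n ^ 'n) set) \<noteq> {}" by blast
  next
    fix A assume "A \<in> (scalars :: ('k ^ 'n ^ 'n) set)"
    then obtain c where "A = mat c" "c \<noteq> 0" by blast
    then show "inv\<^bsub>GL\<^esub> A \<in> scalars" using inv by auto
  next
    fix A B assume "A \<in> (scalars :: ('k ^ 'n ^ 'n) set)" "B \<in> (scalars :: ('k ^ 'n ^ 'n) set)"
    then show "A \<otimes>\<^bsub>GL\<^esub> B \<in> scalars" by (auto simp: GL_def mat_mult_mat)
  qed
  moreover have "scalars #>\<^bsub>GL\<^esub> A = A <#\<^bsub>GL\<^esub> scalars" for A :: "'k ^ 'n ^ 'n"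
    unfolding r_coset_def l_coset_def by (auto simp: GL_def mat_commute)
  ultimately show ?thesis by (intro GL.normalI) auto
qed

lemma group_PGL: "group (PGL :: ('k::field ^ 'n ^ 'n) set monoid)"
  unfolding PGL_def by (rule normal.factorgroup_is_group[OF normal_scalars])

lemma PGL_cases:
  assumes "C \<in> carrier PGL"
  obtains A :: "'k::field ^ 'n ^ 'n" where "invertible A" "C = scalars #>\<^bsub>GL\<^esub> A"
  using assms unfolding PGL_def carrier_FactGroup by (auto simp: GL_def)

lemma projective_space_smult:
  "L \<in> projective_space \<Longrightarrow> v \<in> L \<Longrightarrow> c *s v \<in> L"
  by (auto simp: projective_space_def vec.subspace_scale)

lemma PGL_action_coset:
  fixes A :: "'k::field ^ 'n ^ 'n"
  assumes L: "L \<in> projective_space"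
  shows "PGL_action (scalars #>\<^bsub>GL\<^esub> A) L = (*v) A ` L"
proof -
  have "(\<Union>B\<in>scalars #>\<^bsub>GL\<^esub> A. (*v) B ` L) = (\<Union>c\<in>{c. c \<noteq> 0}. (\<lambda>v. A *v (c *s v)) ` L)"
    unfolding r_coset_def
    by (auto simp: GL_def matrix_vector_mul_assoc[symmetric] mat_mult_vec vec.scale)
  also have "\<dots> = (*v) A ` L"
  proof
    show "(\<Union>c\<in>{c. c \<noteq> 0}. (\<lambda>v. A *v (c *s v)) ` L) \<subseteq> (*v) A ` L"
      using projective_space_smult[OF L] by blast
    show "(*v) A ` L \<subseteq> (\<Union>c\<in>{c. c \<noteq> 0}. (\<lambda>v. A *v (c *s v)) ` L)"
      by (intro subsetI UN_I[of 1]) auto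
  qed
  finally show ?thesis using L by (simp add: PGL_action_def)
qed

lemma image_line:
  fixes A :: "'k::field ^ 'n ^ 'n"
  assumes A: "invertible A" and L: "L \<in> projective_space"
  shows "(*v) A ` L \<in> projective_space"
proof -
  have s: "vec.subspace L" "vec.dim L = 1" using L by (auto simp: projective_space_def)
  have "inj ((*v) A)" using A by (meson invertible_eq_bij bij_is_inj)
  then have "vec.dim ((*v) A ` L) = vec.dim L"
    by (intro vec.dim_image_eq[OF matrix_vector_mul_linear_gen]) (rule inj_on_subset, auto)
  moreover have "vec.subspace ((*v) A ` L)" using vec.subspace_image s(1) by blast
  ultimately show ?thesis using s by (simp add: projective_space_def)
qed

lemma PGL_action_closed:
  assumes "C \<in> carrier (PGL :: ('k::field ^ 'n ^ 'n) set monoid)" "L \<in> projective_space"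
  shows "PGL_action C L \<in> projective_space"
proof -
  obtain A where A: "invertible A" "C = scalars #>\<^bsub>GL\<^esub> A" using PGL_cases[OF assms(1)] by blast
  show ?thesis unfolding A(2) PGL_action_coset[OF assms(2)] by (rule image_line[OF A(1) assms(2)])
qed

lemma PGL_action_one:
  assumes "L \<in> projective_space"
  shows "PGL_action \<one>\<^bsub>PGL :: ('k::field ^ 'n ^ 'n) set monoid\<^esub> L = L"
proof -
  interpret Z: normal "scalars :: ('k ^ 'n ^ 'n) set" GL by (rule normal_scalars)
  have "\<one>\<^bsub>PGL\<^esub> = (scalars :: ('k ^ 'n ^ 'n) set)" by (simp add: PGL_def)
  also have "\<dots> = scalars #>\<^bsub>GL\<^esub> mat 1"
    using Z.coset_mult_one[OF Z.subset] by (simp add: GL_def)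
  finally show ?thesis using PGL_action_coset[OF assms, of "mat 1"] by simp
qed

lemma PGL_action_mult:
  assumes "C \<in> carrier (PGL :: ('k::field ^ 'n ^ 'n) set monoid)" "D \<in> carrier PGL"
    and L: "L \<in> projective_space"
  shows "PGL_action (C \<otimes>\<^bsub>PGL\<^esub> D) L = PGL_action C (PGL_action D L)"
proof -
  interpret Z: normal "scalars :: ('k ^ 'n ^ 'n) set" GL by (rule normal_scalars)
  obtain A where A: "invertible A" "C = scalars #>\<^bsub>GL\<^esub> A" using PGL_cases[OF assms(1)] by blast
  obtain B where B: "invertible B" "D = scalars #>\<^bsub>GL\<^esub> B" using PGL_cases[OF assms(2)] by blast
  have "C \<otimes>\<^bsub>PGL\<^esub> D = scalars #>\<^bsub>GL\<^esub> (A ** B)"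
    using Z.rcos_sum[of A B] A B by (simp add: PGL_def GL_def)
  then have "PGL_action (C \<otimes>\<^bsub>PGL\<^esub> D) L = (*v) (A ** B) ` L"
    by (simp only: PGL_action_coset[OF L])
  also have "\<dots> = (*v) A ` (*v) B ` L" by (simp add: image_image matrix_vector_mul_assoc)
  also have "\<dots> = PGL_action C ((*v) B ` L)"
    unfolding A(2) by (rule PGL_action_coset[OF image_line[OF B(1) L], symmetric])
  also have "(*v) B ` L = PGL_action D L" unfolding B(2) by (rule PGL_action_coset[OF L, symmetric])
  finally show ?thesis .
qed

text \<open>The coordinates of the symmetric tensor \<open>v \<otimes> v\<close>.\<close>

definition square :: "'k::field ^ 'n \<Rightarrow> 'k ^ ('n \<times> 'n)" where
  "square v = (\<chi> ij. v $ fst ij * v $ snd ij)"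

lemma projective_space_generator:
  assumes "L \<in> projective_space"
  obtains w :: "'k::field ^ 'n" where "w \<noteq> 0" "w \<in> L" "\<And>v. v \<in> L \<Longrightarrow> \<exists>a. v = a *s w"
proof -
  obtain B where B: "B \<subseteq> L" "vec.independent B" "L \<subseteq> vec.span B" "card B = vec.dim L"
    using vec.basis_exists by blast
  then obtain w where w: "B = {w}" using assms by (auto simp: projective_space_def card_1_singleton_iff)
  show ?thesis
  proof (rule that)
    show "w \<noteq> 0" using B(2) w vec.dependent_zero by blast
    show "w \<in> L" using B(1) w by blast
    show "\<exists>a. v = a *s w" if "v \<in> L" for v using B(3) w that by (auto simp: vec.span_singleton)
  qed
qed

lemma fixes_line_iff:
  fixes A :: "'k::field ^ 'n ^ 'n"
  assumes A: "invertible A" and L: "L \<in> projective_space"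
  shows "(*v) A ` L = L \<longleftrightarrow> (\<forall>v\<in>L. \<forall>i j. (A *v v) $ i * v $ j = (A *v v) $ j * v $ i)"
proof
  obtain w where w: "w \<noteq> 0" "w \<in> L" "\<And>v. v \<in> L \<Longrightarrow> \<exists>a. v = a *s w"
    using projective_space_generator[OF L] by blast
  {
    assume e: "(*v) A ` L = L"
    show "\<forall>v\<in>L. \<forall>i j. (A *v v) $ i * v $ j = (A *v v) $ j * v $ i"
    proof (intro ballI allI)
      fix v i j assume v: "v \<in> L"
      obtain a where a: "v = a *s w" using w(3)[OF v] by blast
      obtain a' where a': "A *v v = a' *s w" using w(3)[of "A *v v"] v e by blast
      show "(A *v v) $ i * v $ j = (A *v v) $ j * v $ i" unfolding a' unfolding a by simp
    qed
  next
    assume e: "\<forall>v\<in>L. \<forall>i j. (A *v v) $ i * v $ j = (A *v v) $ j * v $ i"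
    obtain j where j: "w $ j \<noteq> 0" using w(1) by (auto simp: vec_eq_iff)
    have "A *v w = ((A *v w) $ j / w $ j) *s w"
      using e w(2) j by (auto simp: vec_eq_iff field_simps)
    then have Aw: "A *v w \<in> L" using projective_space_smult[OF L w(2)] by metis
    have "(*v) A ` L \<subseteq> L"
    proof
      fix u assume "u \<in> (*v) A ` L"
      then obtain v where v: "v \<in> L" "u = A *v v" by blast
      obtain a where "v = a *s w" using w(3)[OF v(1)] by blast
      then show "u \<in> L" using v(2) projective_space_smult[OF L Aw] by (simp add: vec.scale)
    qed
    then show "(*v) A ` L = L"
      using image_line[OF A L] L by (intro vec.subspace_dim_equal) (auto simp: projective_space_def)
  }
qed

text \<open>The linear conditions on a tensor \<open>t\<close> which, for \<open>t = v \<otimes> v\<close>, say that the exterior product of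
\<open>A *v v\<close> and \<open>v\<close> vanishes.\<close>

definition wedge_kernel :: "'k::field ^ 'n ^ 'n \<Rightarrow> ('k ^ ('n \<times> 'n)) set" where
  "wedge_kernel A = {t. \<forall>i j. (\<Sum>l\<in>UNIV. A $ i $ l * t $ (l, j)) = (\<Sum>l\<in>UNIV. A $ j $ l * t $ (l, i))}"

lemma subspace_wedge_kernel: "vec.subspace (wedge_kernel A)"
proof (rule vec.subspaceI)
  show "0 \<in> wedge_kernel A" by (simp add: wedge_kernel_def)
  show "s + t \<in> wedge_kernel A" if "s \<in> wedge_kernel A" "t \<in> wedge_kernel A" for s t
    using that by (simp add: wedge_kernel_def distrib_left sum.distrib)
  show "c *s t \<in> wedge_kernel A" if "t \<in> wedge_kernel A" for c t
  proof -
    have "(\<Sum>l\<in>UNIV. A $ i $ l * (c *s t) $ (l, j)) = c * (\<Sum>l\<in>UNIV. A $ i $ l * t $ (l, j))" for i j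
      unfolding sum_distrib_left by (intro sum.cong refl) (simp add: mult.left_commute)
    then show ?thesis using that by (simp add: wedge_kernel_def)
  qed
qed

lemma square_in_wedge_kernel:
  "square v \<in> wedge_kernel A \<longleftrightarrow> (\<forall>i j. (A *v v) $ i * v $ j = (A *v v) $ j * v $ i)"
proof -
  have "(\<Sum>l\<in>UNIV. A $ i $ l * square v $ (l, j)) = (A *v v) $ i * v $ j" for i j
    by (simp add: square_def matrix_vector_mult_def sum_distrib_right mult.assoc)
  then show ?thesis by (simp add: wedge_kernel_def)
qed

text \<open>The line through \<open>v\<close> is fixed by the class of \<open>A\<close> exactly if \<open>A *v v\<close> is a multiple of \<open>v\<close>, and this
is linear in \<open>v \<otimes> v\<close>. Hence a common fixed point set is cut out by a linear subspace of the
space of tensors, and the dimension of the span of the tensors \<open>v \<otimes> v\<close> over the lines in the set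
is the required rank.\<close>

theorem PGL_bounded_fixpoint_chains:
  assumes Q: "Q \<subseteq> (projective_space :: ('k::field ^ 'n) set set)"
  shows "bounded_fixpoint_chains Q PGL_action (carrier (PGL :: ('k ^ 'n ^ 'n) set monoid))"
proof -
  define rk where "rk Z = vec.dim (square ` \<Union>Z)" for Z :: "('k ^ 'n) set set"
  let ?F = "common_fixpoints Q PGL_action"
  have bound: "rk Z \<le> CARD('n \<times> 'n)" for Z
    unfolding rk_def using vec.dim_subset_UNIV[of "square ` \<Union>Z"] by (simp add: vec.dimension_def card_cart_basis)
  have strict: "rk (?F S) < rk (?F S')"
    if S: "S \<subseteq> carrier PGL" and sub: "?F S \<subset> ?F S'" for S S'
  proof -
    obtain L where L: "L \<in> ?F S'" "L \<notin> ?F S" using sub by blast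
    have LQ: "L \<in> Q" using L(1) by (simp add: common_fixpoints_def)
    then obtain C where C: "C \<in> S" "PGL_action C L \<noteq> L" using L(2) unfolding common_fixpoints_def by blast
    obtain A where A: "invertible A" "C = scalars #>\<^bsub>GL\<^esub> A" using PGL_cases C(1) S by blast
    have "square ` \<Union>(?F S) \<subseteq> wedge_kernel A"
    proof
      fix t assume "t \<in> square ` \<Union>(?F S)"
      then obtain M v where M: "M \<in> ?F S" "v \<in> M" "t = square v" by blast
      have MP: "M \<in> projective_space" using M(1) Q by (auto simp: common_fixpoints_def)
      have "PGL_action C M = M" using M(1) C(1) by (auto simp: common_fixpoints_def)
      then have "(*v) A ` M = M" unfolding A(2) PGL_action_coset[OF MP] .
      then show "t \<in> wedge_kernel A"
        unfolding fixes_line_iff[OF A(1) MP] M(3) square_in_wedge_kernel using M(2) by blast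
    qed
    then have "vec.span (square ` \<Union>(?F S)) \<subseteq> wedge_kernel A"
      using subspace_wedge_kernel by (rule vec.span_minimal)
    moreover have "\<exists>v\<in>L. square v \<notin> wedge_kernel A"
    proof -
      have LP: "L \<in> projective_space" using LQ Q by blast
      have "(*v) A ` L \<noteq> L" using C(2) unfolding A(2) PGL_action_coset[OF LP] .
      then show ?thesis unfolding fixes_line_iff[OF A(1) LP] square_in_wedge_kernel by blast
    qed
    then obtain v where v: "v \<in> L" "square v \<notin> wedge_kernel A" by blast
    ultimately have "square v \<notin> vec.span (square ` \<Union>(?F S))" by blast
    moreover have "square v \<in> vec.span (square ` \<Union>(?F S'))"
      using L(1) v(1) by (intro vec.span_base) blast
    moreover have "vec.span (square ` \<Union>(?F S)) \<subseteq> vec.span (square ` \<Union>(?F S'))"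
      using sub by (intro vec.span_mono) blast
    ultimately have "vec.span (square ` \<Union>(?F S)) \<subset> vec.span (square ` \<Union>(?F S'))" by blast
    then show ?thesis unfolding rk_def by (rule vec.dim_psubset)
  qed
  show ?thesis unfolding bounded_fixpoint_chains_def using bound strict by blast
qed

section \<open>The wreath product as a group acting on a bundle\<close>

locale wreath_setting = G0: group G0 + H: group H
  for G0 :: "('g, 'm) monoid_scheme" and H :: "('h, 'n) monoid_scheme" +
  fixes X0 :: "'x set" and x0 :: 'x and \<phi> :: "'g \<Rightarrow> 'x \<Rightarrow> 'x"
    and P :: "'p set" and \<psi> :: "'h \<Rightarrow> 'p \<Rightarrow> 'p"
  assumes X0_action: "group_action G0 X0 \<phi>" and x0_in: "x0 \<in> X0"
    and \<psi>_closed: "h \<in> carrier H \<Longrightarrow> p \<in> P \<Longrightarrow> \<psi> h p \<in> P"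
    and \<psi>_one: "p \<in> P \<Longrightarrow> \<psi> \<one>\<^bsub>H\<^esub> p = p"
    and \<psi>_mult: "h \<in> carrier H \<Longrightarrow> h' \<in> carrier H \<Longrightarrow> p \<in> P \<Longrightarrow> \<psi> (h \<otimes>\<^bsub>H\<^esub> h') p = \<psi> h (\<psi> h' p)"
begin

abbreviation "W \<equiv> wreath_product G0 P H \<psi>"
abbreviation "wact \<equiv> wreath_action X0 \<phi> P H \<psi>"
abbreviation "XP \<equiv> restricted_product P X0 x0"

lemma \<phi>_one: "x \<in> X0 \<Longrightarrow> \<phi> \<one>\<^bsub>G0\<^esub> x = x"
  using group_action.id_eq_one[OF X0_action] by (metis restrict_apply')

lemma \<phi>_mult: "g \<in> carrier G0 \<Longrightarrow> g' \<in> carrier G0 \<Longrightarrow> x \<in> X0 \<Longrightarrow> \<phi> (g \<otimes>\<^bsub>G0\<^esub> g') x = \<phi> g (\<phi> g' x)"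
  using group_action.composition_rule[OF X0_action] by blast

lemma \<phi>_closed: "g \<in> carrier G0 \<Longrightarrow> x \<in> X0 \<Longrightarrow> \<phi> g x \<in> X0"
  using group_action.element_image[OF X0_action] by blast

lemma \<psi>_inv: "h \<in> carrier H \<Longrightarrow> p \<in> P \<Longrightarrow> \<psi> (inv\<^bsub>H\<^esub> h) (\<psi> h p) = p"
  using \<psi>_mult[of "inv\<^bsub>H\<^esub> h" h p] \<psi>_one by simp

lemma \<psi>_inv': "h \<in> carrier H \<Longrightarrow> p \<in> P \<Longrightarrow> \<psi> h (\<psi> (inv\<^bsub>H\<^esub> h) p) = p"
  using \<psi>_mult[of h "inv\<^bsub>H\<^esub> h" p] \<psi>_one by simp

lemma carrier_W: "w \<in> carrier W \<longleftrightarrow> fst w \<in> P \<rightarrow>\<^sub>E carrier G0 \<and> snd w \<in> carrier H"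
  by (cases w) (simp add: wreath_product_def)

lemma fst_in: "w \<in> carrier W \<Longrightarrow> p \<in> P \<Longrightarrow> fst w p \<in> carrier G0"
  by (auto simp: carrier_W)

lemma snd_in: "w \<in> carrier W \<Longrightarrow> snd w \<in> carrier H"
  by (simp add: carrier_W)

lemma mult_W: "w \<otimes>\<^bsub>W\<^esub> w' =
    (\<lambda>p\<in>P. fst w p \<otimes>\<^bsub>G0\<^esub> fst w' (\<psi> (inv\<^bsub>H\<^esub> snd w) p), snd w \<otimes>\<^bsub>H\<^esub> snd w')"
  by (auto simp: wreath_product_def split_beta)

lemma one_W: "\<one>\<^bsub>W\<^esub> = (\<lambda>p\<in>P. \<one>\<^bsub>G0\<^esub>, \<one>\<^bsub>H\<^esub>)"
  by (simp add: wreath_product_def)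

lemma W_eqI:
  assumes "w \<in> carrier W" "w' \<in> carrier W" "\<And>p. p \<in> P \<Longrightarrow> fst w p = fst w' p" "snd w = snd w'"
  shows "w = w'"
proof -
  have "fst w = fst w'"
    using assms(1,2) by (intro PiE_ext[of _ P "\<lambda>_. carrier G0"]) (auto simp: carrier_W assms(3))
  then show ?thesis using assms(4) by (simp add: prod_eq_iff)
qed

lemma W_closed: "w \<in> carrier W \<Longrightarrow> w' \<in> carrier W \<Longrightarrow> w \<otimes>\<^bsub>W\<^esub> w' \<in> carrier W"
  by (auto simp: mult_W carrier_W \<psi>_closed intro!: G0.m_closed)

lemma group_W: "group W"
proof (rule groupI)
  show one: "\<one>\<^bsub>W\<^esub> \<in> carrier W" by (simp add: one_W carrier_W)
  fix w assume w: "w \<in> carrier W"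
  show "\<one>\<^bsub>W\<^esub> \<otimes>\<^bsub>W\<^esub> w = w"
    by (rule W_eqI[OF W_closed[OF one w] w]) (use w in \<open>simp_all add: mult_W one_W \<psi>_one fst_in snd_in\<close>)
  let ?v = "(\<lambda>p\<in>P. inv\<^bsub>G0\<^esub> fst w (\<psi> (snd w) p), inv\<^bsub>H\<^esub> snd w)"
  have v: "?v \<in> carrier W" using w by (auto simp: carrier_W \<psi>_closed)
  have "?v \<otimes>\<^bsub>W\<^esub> w = \<one>\<^bsub>W\<^esub>"
    by (rule W_eqI[OF W_closed[OF v w] one])
      (use w in \<open>simp_all add: mult_W one_W fst_in snd_in \<psi>_closed\<close>)
  then show "\<exists>v\<in>carrier W. v \<otimes>\<^bsub>W\<^esub> w = \<one>\<^bsub>W\<^esub>" using v by blast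
next
  fix u v w assume c: "u \<in> carrier W" "v \<in> carrier W" "w \<in> carrier W"
  show "u \<otimes>\<^bsub>W\<^esub> v \<otimes>\<^bsub>W\<^esub> w = u \<otimes>\<^bsub>W\<^esub> (v \<otimes>\<^bsub>W\<^esub> w)"
    by (rule W_eqI)
      (use c in \<open>simp_all add: W_closed\<close>,
       simp_all add: mult_W fst_in snd_in \<psi>_closed \<psi>_mult H.inv_mult_group G0.m_assoc H.m_assoc)
qed (rule W_closed)

lemma wact_apply:
  "x \<in> P \<rightarrow>\<^sub>E X0 \<Longrightarrow> wact w x = (\<lambda>p\<in>P. \<phi> (fst w p) (x (\<psi> (inv\<^bsub>H\<^esub> snd w) p)))"
  by (simp add: wreath_action_def split_beta)

lemma wact_closed: "w \<in> carrier W \<Longrightarrow> x \<in> P \<rightarrow>\<^sub>E X0 \<Longrightarrow> wact w x \<in> P \<rightarrow>\<^sub>E X0"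
  by (auto simp: wact_apply fst_in snd_in \<psi>_closed intro!: \<phi>_closed)

lemma wact_mult:
  assumes w: "w \<in> carrier W" "w' \<in> carrier W" and x: "x \<in> P \<rightarrow>\<^sub>E X0"
  shows "wact (w \<otimes>\<^bsub>W\<^esub> w') x = wact w (wact w' x)"
proof
  fix p
  have inX: "x q \<in> X0" if "q \<in> P" for q using x that by auto
  have "wact w (wact w' x) = (\<lambda>p\<in>P. \<phi> (fst w p) (wact w' x (\<psi> (inv\<^bsub>H\<^esub> snd w) p)))"
    by (rule wact_apply[OF wact_closed[OF w(2) x]])
  then show "wact (w \<otimes>\<^bsub>W\<^esub> w') x p = wact w (wact w' x) p"
    using w by (auto simp: wact_apply[OF x] mult_W fst_in snd_in \<psi>_closed H.inv_mult_group \<psi>_mult \<phi>_mult inX)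
qed

lemma wact_one:
  assumes x: "x \<in> P \<rightarrow>\<^sub>E X0"
  shows "wact \<one>\<^bsub>W\<^esub> x = x"
proof (rule PiE_ext[OF wact_closed[OF _ x] x])
  show "\<one>\<^bsub>W\<^esub> \<in> carrier W" by (simp add: one_W carrier_W)
  fix p assume p: "p \<in> P"
  then have "x p \<in> X0" using x by auto
  then show "wact \<one>\<^bsub>W\<^esub> x p = x p" using p by (simp add: wact_apply[OF x] one_W \<psi>_one \<phi>_one)
qed

lemma XP_sub: "XP \<subseteq> P \<rightarrow>\<^sub>E X0"
  by (auto simp: restricted_product_def)

lemma G_oplus_eq: "G_oplus G0 X0 x0 \<phi> P H \<psi> = W\<lparr>carrier := {w \<in> carrier W. wact w ` XP = XP}\<rparr>"
  by (simp add: G_oplus_def)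

lemma G_oplus_subgroup: "subgroup {w \<in> carrier W. wact w ` XP = XP} W"
proof -
  interpret W: group W by (rule group_W)
  show ?thesis
  proof (rule W.subgroupI)
    have "wact \<one>\<^bsub>W\<^esub> ` XP = XP" using wact_one XP_sub by (auto simp: image_iff subset_iff)
    then show "{w \<in> carrier W. wact w ` XP = XP} \<noteq> {}" using W.one_closed by blast
  next
    fix w assume "w \<in> {w \<in> carrier W. wact w ` XP = XP}"
    then have w: "w \<in> carrier W" "wact w ` XP = XP" by auto
    have "wact (inv\<^bsub>W\<^esub> w) ` (wact w ` XP) = (\<lambda>x. wact (inv\<^bsub>W\<^esub> w \<otimes>\<^bsub>W\<^esub> w) x) ` XP"
      unfolding image_image using wact_mult[OF W.inv_closed[OF w(1)] w(1)] XP_sub by (intro image_cong) auto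
    also have "\<dots> = (\<lambda>x. x) ` XP" using w(1) wact_one XP_sub by (intro image_cong) auto
    finally show "inv\<^bsub>W\<^esub> w \<in> {w \<in> carrier W. wact w ` XP = XP}" using w by simp
  next
    fix u w assume "u \<in> {w \<in> carrier W. wact w ` XP = XP}" "w \<in> {w \<in> carrier W. wact w ` XP = XP}"
    then have c: "u \<in> carrier W" "w \<in> carrier W" "wact u ` XP = XP" "wact w ` XP = XP" by auto
    have "(\<lambda>x. wact (u \<otimes>\<^bsub>W\<^esub> w) x) ` XP = wact u ` (wact w ` XP)"
      unfolding image_image using wact_mult[OF c(1,2)] XP_sub by (intro image_cong) auto
    then show "u \<otimes>\<^bsub>W\<^esub> w \<in> {w \<in> carrier W. wact w ` XP = XP}" using c by simp
  qed auto
qed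

lemma group_G_oplus: "group (G_oplus G0 X0 x0 \<phi> P H \<psi>)"
  unfolding G_oplus_eq by (rule group.subgroup_imp_group[OF group_W G_oplus_subgroup])

definition coord_act :: "('p \<Rightarrow> 'g) \<times> 'h \<Rightarrow> 'p \<Rightarrow> 'p" where
  "coord_act w p = \<psi> (snd w) p"

definition coord_tr :: "('p \<Rightarrow> 'g) \<times> 'h \<Rightarrow> 'p \<Rightarrow> 'x \<Rightarrow> 'x" where
  "coord_tr w p x = \<phi> (fst w (\<psi> (snd w) p)) x"

text \<open>Flatness at \<open>p\<close> is the equation of the fixed point at the coordinate \<open>\<psi> (snd w) p\<close>.\<close>

lemma fixed_iff_flat:
  assumes w: "w \<in> carrier W" and y: "y \<in> P \<rightarrow>\<^sub>E X0"
  shows "wact w y = y \<longleftrightarrow> (\<forall>p\<in>P. flat coord_act coord_tr w y p)"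
proof
  have h: "snd w \<in> carrier H" using w by (rule snd_in)
  {
    assume e: "wact w y = y"
    show "\<forall>p\<in>P. flat coord_act coord_tr w y p"
    proof
      fix p assume p: "p \<in> P"
      have "wact w y (\<psi> (snd w) p) = y (\<psi> (snd w) p)" using e by simp
      then show "flat coord_act coord_tr w y p"
        using p h by (simp add: wact_apply[OF y] flat_def coord_act_def coord_tr_def \<psi>_closed \<psi>_inv)
    qed
  next
    assume f: "\<forall>p\<in>P. flat coord_act coord_tr w y p"
    show "wact w y = y"
    proof (rule PiE_ext[OF wact_closed[OF w y] y])
      fix q assume q: "q \<in> P"
      have "flat coord_act coord_tr w y (\<psi> (inv\<^bsub>H\<^esub> snd w) q)" using f q h \<psi>_closed by simp
      then show "wact w y q = y q"
        using q h by (simp add: wact_apply[OF y] flat_def coord_act_def coord_tr_def \<psi>_inv')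
    qed
  }
qed

lemma restrict_in_XP: "finite_section P X0 x0 y \<Longrightarrow> restrict y P \<in> XP"
  by (auto simp: finite_section_def restricted_product_def elim: rev_finite_subset)

lemma XP_section: "y \<in> XP \<Longrightarrow> finite_section P X0 x0 y"
  by (auto simp: finite_section_def restricted_product_def)

lemma flat_restrict:
  assumes "w \<in> carrier W" "p \<in> P"
  shows "flat coord_act coord_tr w (restrict y P) p \<longleftrightarrow> flat coord_act coord_tr w y p"
  using assms by (simp add: flat_def coord_act_def \<psi>_closed snd_in)

text \<open>The constant section is almost flat because \<open>w\<close> preserves the restricted product: the image of the
constant section under \<open>w\<close> again equals \<open>x0\<close> almost everywhere.\<close>

lemma coordinate_bundle:
  assumes \<Gamma>: "subgroup \<Gamma> (G_oplus G0 X0 x0 \<phi> P H \<psi>)"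
  shows "bundle_action ((G_oplus G0 X0 x0 \<phi> P H \<psi>)\<lparr>carrier := \<Gamma>\<rparr>) P coord_act X0 coord_tr x0"
    (is "bundle_action ?G _ _ _ _ _")
proof -
  have G: "group ?G" using group.subgroup_imp_group[OF group_G_oplus \<Gamma>] .
  have \<Gamma>W: "w \<in> carrier W \<and> wact w ` XP = XP" if "w \<in> \<Gamma>" for w
    using subgroup.subset[OF \<Gamma>] that by (auto simp: G_oplus_eq)
  have m: "w \<otimes>\<^bsub>?G\<^esub> w' = w \<otimes>\<^bsub>W\<^esub> w'" for w w' by (simp add: G_oplus_eq)
  have o: "\<one>\<^bsub>?G\<^esub> = \<one>\<^bsub>W\<^esub>" by (simp add: G_oplus_eq)
  show ?thesis
  proof (intro bundle_action.intro G bundle_action_axioms.intro)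
    fix w p assume wp: "w \<in> carrier ?G" "p \<in> P"
    then have w: "w \<in> carrier W" using \<Gamma>W by simp
    show "coord_act w p \<in> P" using w wp(2) by (simp add: coord_act_def \<psi>_closed snd_in)
    show "coord_tr w p x \<in> X0" if "x \<in> X0" for x
      using w wp(2) that by (simp add: coord_tr_def \<psi>_closed snd_in fst_in \<phi>_closed)
    fix w' assume "w' \<in> carrier ?G"
    then have w': "w' \<in> carrier W" using \<Gamma>W by simp
    show "coord_act (w' \<otimes>\<^bsub>?G\<^esub> w) p = coord_act w' (coord_act w p)"
      using w w' wp(2) unfolding m by (simp add: coord_act_def mult_W \<psi>_mult snd_in)
    show "coord_tr (w' \<otimes>\<^bsub>?G\<^esub> w) p x = coord_tr w' (coord_act w p) (coord_tr w p x)" if "x \<in> X0" for x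
      using w w' wp(2) that unfolding m
      by (simp add: coord_act_def coord_tr_def mult_W \<psi>_mult snd_in \<psi>_closed \<psi>_inv fst_in \<phi>_mult)
  next
    fix p assume p: "p \<in> P"
    show "coord_act \<one>\<^bsub>?G\<^esub> p = p" unfolding o using p by (simp add: coord_act_def one_W \<psi>_one)
    show "coord_tr \<one>\<^bsub>?G\<^esub> p x = x" if "x \<in> X0" for x
      unfolding o using p that by (simp add: coord_tr_def one_W \<psi>_one \<phi>_one)
  next
    show "x0 \<in> X0" by (rule x0_in)
    fix w assume "w \<in> carrier ?G"
    then have w: "w \<in> carrier W" "wact w ` XP = XP" using \<Gamma>W by simp_all
    have h: "snd w \<in> carrier H" using w(1) by (rule snd_in)
    let ?b = "\<lambda>p\<in>P. x0"
    have b: "?b \<in> XP" using x0_in by (simp add: restricted_product_def)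
    then have "wact w ?b \<in> XP" using w(2) by blast
    then have fin: "finite {p \<in> P. wact w ?b p \<noteq> x0}" by (simp add: restricted_product_def)
    have "{p \<in> P. coord_tr w p x0 \<noteq> x0} \<subseteq> \<psi> (inv\<^bsub>H\<^esub> snd w) ` {p \<in> P. wact w ?b p \<noteq> x0}"
    proof
      fix p assume p: "p \<in> {p \<in> P. coord_tr w p x0 \<noteq> x0}"
      then have "\<psi> (snd w) p \<in> {p \<in> P. wact w ?b p \<noteq> x0}"
        using h b XP_sub by (auto simp: wact_apply coord_tr_def \<psi>_closed \<psi>_inv)
      moreover have "p = \<psi> (inv\<^bsub>H\<^esub> snd w) (\<psi> (snd w) p)" using p h \<psi>_inv by simp
      ultimately show "p \<in> \<psi> (inv\<^bsub>H\<^esub> snd w) ` {p \<in> P. wact w ?b p \<noteq> x0}" by blast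
    qed
    then show "finite {p \<in> P. coord_tr w p x0 \<noteq> x0}" using fin finite_surj by blast
  qed
qed

text \<open>On the stabiliser of \<open>p\<close>, taking the coordinate at \<open>p\<close> is a homomorphism to \<open>G0\<close>, and the transport
of the fibre over \<open>p\<close> is the action of that coordinate on \<open>X0\<close>.\<close>

lemma decent_fibre:
  assumes dec: "decent_action G0 X0 \<phi>" and \<Gamma>: "subgroup \<Gamma> (G_oplus G0 X0 x0 \<phi> P H \<psi>)"
    and p: "p \<in> P" and Y: "finite Y" "Y \<subseteq> \<Gamma>"
    and stab: "\<And>w. w \<in> generate ((G_oplus G0 X0 x0 \<phi> P H \<psi>)\<lparr>carrier := \<Gamma>\<rparr>) Y \<Longrightarrow> w \<in> \<Gamma> \<and> coord_act w p = p"
    and ell: "\<And>w. w \<in> generate ((G_oplus G0 X0 x0 \<phi> P H \<psi>)\<lparr>carrier := \<Gamma>\<rparr>) Y \<Longrightarrow> \<exists>x\<in>X0. coord_tr w p x = x"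
  shows "\<exists>x\<in>X0. \<forall>w\<in>generate ((G_oplus G0 X0 x0 \<phi> P H \<psi>)\<lparr>carrier := \<Gamma>\<rparr>) Y. coord_tr w p x = x"
proof -
  let ?G = "(G_oplus G0 X0 x0 \<phi> P H \<psi>)\<lparr>carrier := \<Gamma>\<rparr>"
  interpret G: group ?G using group.subgroup_imp_group[OF group_G_oplus \<Gamma>] .
  let ?K = "generate ?G Y"
  have \<Gamma>W: "w \<in> carrier W" if "w \<in> \<Gamma>" for w
    using subgroup.subset[OF \<Gamma>] that by (auto simp: G_oplus_eq)
  have K: "subgroup ?K ?G" using G.generate_is_subgroup Y(2) by simp
  let ?GK = "?G\<lparr>carrier := ?K\<rparr>"
  interpret GK: group ?GK using G.subgroup_imp_group[OF K] .
  have YK: "Y \<subseteq> ?K" by (auto intro: generate.incl)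
  have "(\<lambda>w. fst w p) \<in> hom ?GK G0"
  proof (rule homI)
    fix w assume "w \<in> carrier ?GK"
    then show "fst w p \<in> carrier G0" using stab \<Gamma>W fst_in p by simp
    fix w' assume w': "w' \<in> carrier ?GK"
    have "coord_act w p = p" "w \<in> carrier W" using \<open>w \<in> carrier ?GK\<close> stab \<Gamma>W by auto
    then have "\<psi> (inv\<^bsub>H\<^esub> snd w) p = p" using \<psi>_inv[of "snd w" p] p snd_in by (simp add: coord_act_def)
    then show "fst (w \<otimes>\<^bsub>?GK\<^esub> w') p = fst w p \<otimes>\<^bsub>G0\<^esub> fst w' p"
      using p by (simp add: G_oplus_eq mult_W)
  qed
  then interpret h: group_hom ?GK G0 "\<lambda>w. fst w p" by unfold_locales
  let ?im = "(\<lambda>w. fst w p) ` ?K"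
  have K0: "subgroup ?im G0" using h.subgroup_img_is_subgroup[OF GK.subgroup_self] by simp
  have tr: "coord_tr w p = \<phi> (fst w p)" if "w \<in> ?K" for w
    using stab[OF that] by (auto simp: coord_tr_def coord_act_def)
  have genK: "generate ?GK Y = ?K" using G.generate_consistent[OF YK K] by simp
  have "generate G0 ((\<lambda>w. fst w p) ` Y) = ?im" using h.generate_img[of Y] YK genK by simp
  moreover have "generate (G0\<lparr>carrier := ?im\<rparr>) ((\<lambda>w. fst w p) ` Y) = generate G0 ((\<lambda>w. fst w p) ` Y)"
    using YK by (intro G0.generate_consistent K0) blast
  ultimately have "finitely_generated (G0\<lparr>carrier := ?im\<rparr>)"
    unfolding finitely_generated_def using Y(1) YK
    by (intro exI[of _ "(\<lambda>w. fst w p) ` Y"]) auto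
  moreover have "purely_elliptic (G0\<lparr>carrier := ?im\<rparr>) X0 \<phi>"
    unfolding purely_elliptic_def using ell tr by auto
  ultimately have "fixes_point (G0\<lparr>carrier := ?im\<rparr>) X0 \<phi>"
    using dec K0 unfolding decent_action_def by blast
  then show ?thesis unfolding fixes_point_def using tr by auto
qed

end

section \<open>Virtually solvable projections\<close>

lemma exp_of_derived_consistent:
  assumes "group G" "subgroup K G"
  shows "(derived (G\<lparr>carrier := K\<rparr>) ^^ n) K = (derived G ^^ n) K \<and> (derived G ^^ n) K \<subseteq> K"
proof (induct n)
  case (Suc n)
  interpret group G by (rule assms(1))
  have "derived G ((derived G ^^ n) K) \<subseteq> K" using derived_incl[OF _ assms(2)] Suc by blast
  then show ?case using Suc derived_consistent[OF _ assms(2)] by simp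
qed simp

text \<open>A solvable subgroup of finite index in the quotient is pulled back and replaced by its normal core
\<open>L\<close>. The derived series of \<open>L\<close> consists of normal subgroups and reaches the kernel.\<close>

lemma virtually_solvable_pullback:
  assumes hom: "group_hom G D f" and surj: "f ` carrier G = carrier D" and vs: "virtually_solvable D"
  shows "\<exists>L n. L \<lhd> G \<and> finite_index G L \<and> (\<forall>a\<in>(derived G ^^ n) L. f a = \<one>\<^bsub>D\<^esub>)"
proof -
  interpret group_hom G D f by (rule hom)
  obtain K where K: "subgroup K D" "finite (rcosets\<^bsub>D\<^esub> K)" "solvable (D\<lparr>carrier := K\<rparr>)"
    using vs unfolding virtually_solvable_def by blast
  obtain n where "(derived (D\<lparr>carrier := K\<rparr>) ^^ n) K = {\<one>\<^bsub>D\<^esub>}"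
    using group.solvable_iff_trivial_derived_seq[OF H.subgroup_imp_group[OF K(1)]] K(3) by auto
  then have n: "(derived D ^^ n) K = {\<one>\<^bsub>D\<^esub>}" using exp_of_derived_consistent[OF H.group_axioms K(1)] by metis
  define K' where "K' = {a \<in> carrier G. f a \<in> K}"
  have K': "subgroup K' G"
  proof (rule G.subgroupI)
    have "\<one>\<^bsub>G\<^esub> \<in> K'" unfolding K'_def using subgroup.one_closed[OF K(1)] by simp
    then show "K' \<noteq> {}" by blast
  qed (auto simp: K'_def subgroup.m_inv_closed[OF K(1)] subgroup.m_closed[OF K(1)])
  have "finite_index G K'"
  proof (rule G.finite_index_by_invariant[where f = "\<lambda>a. K #>\<^bsub>D\<^esub> f a"])
    have "(\<lambda>a. K #>\<^bsub>D\<^esub> f a) ` carrier G \<subseteq> rcosets\<^bsub>D\<^esub> K" by (auto simp: RCOSETS_def intro: hom_closed)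
    then show "finite ((\<lambda>a. K #>\<^bsub>D\<^esub> f a) ` carrier G)" using K(2) finite_subset by blast
    fix a b assume ab: "a \<in> carrier G" "b \<in> carrier G" "K #>\<^bsub>D\<^esub> f a = K #>\<^bsub>D\<^esub> f b"
    then have "f a \<in> K #>\<^bsub>D\<^esub> f b" using H.rcos_self[OF _ K(1), of "f a"] by simp
    then obtain k where "k \<in> K" "f a = k \<otimes>\<^bsub>D\<^esub> f b" unfolding r_coset_def by blast
    then have "f a \<otimes>\<^bsub>D\<^esub> inv\<^bsub>D\<^esub> f b \<in> K"
      using ab subgroup.mem_carrier[OF K(1)] by (simp add: H.m_assoc)
    then show "a \<otimes>\<^bsub>G\<^esub> inv\<^bsub>G\<^esub> b \<in> K'" unfolding K'_def using ab by simp
  qed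
  then obtain L where L: "L \<lhd> G" "L \<subseteq> K'" "finite_index G L"
    using G.normal_core_finite_index[OF K'] by blast
  have LG: "L \<subseteq> carrier G" using L(2) unfolding K'_def by blast
  have "f ` ((derived G ^^ n) L) = (derived D ^^ n) (f ` L)" using exp_of_derived_img[OF LG] by simp
  also have "\<dots> \<subseteq> (derived D ^^ n) K" using L(2) by (intro H.mono_exp_of_derived) (auto simp: K'_def)
  finally have "\<forall>a\<in>(derived G ^^ n) L. f a = \<one>\<^bsub>D\<^esub>" using n by blast
  then show ?thesis using L(1,3) by blast
qed

section \<open>Groups with virtually solvable projection fix a point\<close>

theorem lemma1p9:
  fixes G0 :: "('g, 'm) monoid_scheme"
    and X0 :: "'x set" and x0 :: 'x and \<phi> :: "'g \<Rightarrow> 'x \<Rightarrow> 'x"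
    and P :: "('k::field ^ 3) set set" and H :: "('k ^ 3 ^ 3) set monoid"
    and XP :: "(('k ^ 3) set \<Rightarrow> 'x) set"
    and \<Gamma> :: "((('k ^ 3) set \<Rightarrow> 'g) \<times> ('k ^ 3 ^ 3) set) set"
  assumes "group G0" and "decent_action G0 X0 \<phi>" and "x0 \<in> X0"
    and "P = projective_space" and "H = PGL" and "XP = restricted_product P X0 x0"
    and "subgroup \<Gamma> (G_oplus G0 X0 x0 \<phi> P H PGL_action)"
    and "finitely_generated ((G_oplus G0 X0 x0 \<phi> P H PGL_action)\<lparr>carrier := \<Gamma>\<rparr>)"
    and "purely_elliptic ((G_oplus G0 X0 x0 \<phi> P H PGL_action)\<lparr>carrier := \<Gamma>\<rparr>) XP
           (wreath_action X0 \<phi> P H PGL_action)"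
    and "virtually_solvable (H\<lparr>carrier := snd ` \<Gamma>\<rparr>)"
  shows "fixes_point ((G_oplus G0 X0 x0 \<phi> P H PGL_action)\<lparr>carrier := \<Gamma>\<rparr>) XP
           (wreath_action X0 \<phi> P H PGL_action)"
proof -
  let ?GO = "G_oplus G0 X0 x0 \<phi> P H PGL_action"
  let ?G = "?GO\<lparr>carrier := \<Gamma>\<rparr>"
  interpret S: wreath_setting G0 H X0 x0 \<phi> P PGL_action
  proof (intro wreath_setting.intro wreath_setting_axioms.intro)
    show "group G0" "group H" using assms(1,5) group_PGL by simp_all
    show "group_action G0 X0 \<phi>" using assms(2) by (simp add: decent_action_def)
  qed (simp_all add: assms(3-5) PGL_action_closed PGL_action_one PGL_action_mult)
  interpret B: bundle_action ?G P S.coord_act X0 S.coord_tr x0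
    by (rule S.coordinate_bundle[OF assms(7)])
  have \<Gamma>W: "w \<in> carrier S.W" if "w \<in> \<Gamma>" for w
    using subgroup.subset[OF assms(7)] that by (auto simp: S.G_oplus_eq)
  let ?D = "H\<lparr>carrier := snd ` \<Gamma>\<rparr>"
  have hom: "snd \<in> hom ?G H"
    by (rule homI) (simp_all add: S.G_oplus_eq S.mult_W S.snd_in \<Gamma>W)
  then interpret s: group_hom ?G H snd by unfold_locales
  have Dsub: "subgroup (snd ` \<Gamma>) H" using s.subgroup_img_is_subgroup[OF B.subgroup_self] by simp
  have "group_hom ?G ?D snd"
    using S.H.subgroup_imp_group[OF Dsub] s.hom_mult
    by (intro group_hom.intro group_hom_axioms.intro B.is_group) (auto simp: hom_def)
  from virtually_solvable_pullback[OF this _ assms(10)] obtain L n where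
    L: "L \<lhd> ?G" "finite_index ?G L" "\<And>a. a \<in> (derived ?G ^^ n) L \<Longrightarrow> snd a = \<one>\<^bsub>H\<^esub>" by auto
  have "\<exists>y. B.sect y \<and> (\<forall>a\<in>carrier ?G. \<forall>p\<in>P. B.flt a y p)"
  proof (rule B.fixed_section[OF assms(8) _ _ _ L(1,2)])
    fix a assume a: "a \<in> carrier ?G"
    then obtain y where y: "y \<in> XP" "wreath_action X0 \<phi> P H PGL_action a y = y"
      using assms(9) unfolding purely_elliptic_def by blast
    have "y \<in> P \<rightarrow>\<^sub>E X0" using y(1) S.XP_sub assms(6) by blast
    then have "\<forall>p\<in>P. B.flt a y p" using S.fixed_iff_flat y(2) \<Gamma>W a by simp
    then show "\<exists>y. B.sect y \<and> (\<forall>p\<in>P. B.flt a y p)" using S.XP_section y(1) assms(6) by blast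
  next
    fix Q assume Q: "Q \<subseteq> P"
    have fp: "common_fixpoints Q S.coord_act T = common_fixpoints Q PGL_action (snd ` T)" for T
      by (simp add: common_fixpoints_def S.coord_act_def)
    have sub: "snd ` T \<subseteq> carrier PGL" if "T \<subseteq> \<Gamma>" for T
      using that S.snd_in \<Gamma>W assms(5) by blast
    have "bounded_fixpoint_chains Q PGL_action (carrier (PGL :: ('k ^ 3 ^ 3) set monoid))"
      using PGL_bounded_fixpoint_chains Q assms(4) by blast
    then show "bounded_fixpoint_chains Q S.coord_act (carrier ?G)"
      unfolding bounded_fixpoint_chains_def fp using sub by (auto, metis)
  next
    fix p Y
    assume "p \<in> P" "finite Y" "generate ?G Y \<subseteq> {a \<in> carrier ?G. S.coord_act a p = p}"
      "Y \<subseteq> carrier ?G" "\<And>a. a \<in> generate ?G Y \<Longrightarrow> \<exists>x\<in>X0. S.coord_tr a p x = x"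
    then show "\<exists>x\<in>X0. \<forall>a\<in>generate ?G Y. S.coord_tr a p x = x"
      by (intro S.decent_fibre[OF assms(2,7)]) auto
  next
    fix a p assume "a \<in> (derived ?G ^^ n) L" "p \<in> P"
    then show "S.coord_act a p = p" using L(3) S.\<psi>_one by (simp add: S.coord_act_def)
  qed
  then obtain y where y: "B.sect y" "\<And>a p. a \<in> \<Gamma> \<Longrightarrow> p \<in> P \<Longrightarrow> B.flt a y p" by auto
  have yX: "restrict y P \<in> XP" using S.restrict_in_XP[OF y(1)] assms(6) by simp
  have "wreath_action X0 \<phi> P H PGL_action a (restrict y P) = restrict y P" if a: "a \<in> \<Gamma>" for a
    using S.fixed_iff_flat[OF \<Gamma>W[OF a], of "restrict y P"] S.flat_restrict[OF \<Gamma>W[OF a]] y(2)[OF a]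
      yX S.XP_sub assms(6) by blast
  then show ?thesis unfolding fixes_point_def using yX by (intro bexI[of _ "restrict y P"]) simp_all
qed

end
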